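(* For each of the groups $\mathbb{Z}/11\mathbb{Z}\oplus\mathbb{Z}^2$, $\mathbb{Z}/13\mathbb{Z}\oplus\mathbb{Z}$, $\mathbb{Z}/15\mathbb{Z}\oplus\mathbb{Z}$, $\mathbb{Z}/16\mathbb{Z}\oplus\mathbb{Z}$, $\mathbb{Z}/20\mathbb{Z}\oplus\mathbb{Z}$, $\mathbb{Z}/2\mathbb{Z}\oplus\mathbb{Z}/10\mathbb{Z}\oplus\mathbb{Z}$, $\mathbb{Z}/2\mathbb{Z}\oplus\mathbb{Z}/12\mathbb{Z}\oplus\mathbb{Z}$, and $\mathbb{Z}/2\mathbb{Z}\oplus\mathbb{Z}/14\mathbb{Z}\oplus\mathbb{Z}$, there exist a cubic number field $K$ and an elliptic curve $E$ over $K$ whose Mordell--Weil group $E(K)$ contains a subgroup isomorphic to that group. *)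

theory Defs
  imports Complex_Main "HOL-Algebra.Algebra" "HOL-Algebra.Algebraic_Closure_Type"
begin

section \<open>Cubic number fields\<close>

text \<open>
  Every number field embeds into the complex numbers, so number fields are represented as
  subfields of \<^typ>\<open>complex\<close>. The complex field as a record is
  \<^term>\<open>ring_of_type_algebra :: complex ring\<close>, and \<^term>\<open>\<rat> :: complex set\<close> is its prime field.
\<close>

definition cubic_number_field :: "complex set \<Rightarrow> bool" where
  "cubic_number_field K \<longleftrightarrow>
     subfield K (ring_of_type_algebra :: complex ring) \<and>
     ring.dimension (ring_of_type_algebra :: complex ring) 3 \<rat> K"


section \<open>Elliptic curves in Weierstrass form\<close>

text \<open>
  A value of this type stands for the equation
  \<open>y\<^sup>2 + a\<^sub>1 x y + a\<^sub>3 y = x\<^sup>3 + a\<^sub>2 x\<^sup>2 + a\<^sub>4 x + a\<^sub>6\<close>.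
\<close>

datatype 'a weierstrass =
  Weierstrass (a1: 'a) (a2: 'a) (a3: 'a) (a4: 'a) (a6: 'a)

definition b2 :: "'a::field weierstrass \<Rightarrow> 'a" where
  "b2 E = (a1 E)\<^sup>2 + 4 * a2 E"

definition b4 :: "'a::field weierstrass \<Rightarrow> 'a" where
  "b4 E = 2 * a4 E + a1 E * a3 E"

definition b6 :: "'a::field weierstrass \<Rightarrow> 'a" where
  "b6 E = (a3 E)\<^sup>2 + 4 * a6 E"

definition b8 :: "'a::field weierstrass \<Rightarrow> 'a" where
  "b8 E = (a1 E)\<^sup>2 * a6 E + 4 * a2 E * a6 E - a1 E * a3 E * a4 E + a2 E * (a3 E)\<^sup>2 - (a4 E)\<^sup>2"

definition discriminant :: "'a::field weierstrass \<Rightarrow> 'a" where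
  "discriminant E =
     - (b2 E)\<^sup>2 * b8 E - 8 * (b4 E) ^ 3 - 27 * (b6 E)\<^sup>2 + 9 * b2 E * b4 E * b6 E"

definition elliptic_curve_over :: "'a::field set \<Rightarrow> 'a weierstrass \<Rightarrow> bool" where
  "elliptic_curve_over K E \<longleftrightarrow> set_weierstrass E \<subseteq> K \<and> discriminant E \<noteq> 0"


section \<open>The Mordell--Weil group\<close>

datatype 'a point = Infinity | Affine 'a 'a

fun on_curve :: "'a::field weierstrass \<Rightarrow> 'a point \<Rightarrow> bool" where
  "on_curve E Infinity \<longleftrightarrow> True"
| "on_curve E (Affine x y) \<longleftrightarrow>
     y\<^sup>2 + a1 E * x * y + a3 E * y = x ^ 3 + a2 E * x\<^sup>2 + a4 E * x + a6 E"

definition rational_points :: "'a::field set \<Rightarrow> 'a weierstrass \<Rightarrow> 'a point set" where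
  "rational_points K E = {P. on_curve E P \<and> set_point P \<subseteq> K}"

text \<open>
  The chord-tangent law. The inverse of \<open>(x, y)\<close> is \<open>(x, - y - a\<^sub>1 x - a\<^sub>3)\<close>, so the first test
  below says that the two points are mutually inverse. If they are not but share their abscissa,
  they coincide, and \<open>l\<close> is the slope of the tangent line.
\<close>

fun point_add :: "'a::field weierstrass \<Rightarrow> 'a point \<Rightarrow> 'a point \<Rightarrow> 'a point" where
  "point_add E Infinity Q = Q"
| "point_add E P Infinity = P"
| "point_add E (Affine x1 y1) (Affine x2 y2) =
     (if x1 = x2 \<and> y1 + y2 + a1 E * x2 + a3 E = 0 then Infinity
      else
        let l = (if x1 = x2
                 then (3 * x1\<^sup>2 + 2 * a2 E * x1 + a4 E - a1 E * y1) / (2 * y1 + a1 E * x1 + a3 E)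
                 else (y2 - y1) / (x2 - x1));
            x3 = l\<^sup>2 + a1 E * l - a2 E - x1 - x2
        in Affine x3 (- (y1 + l * (x3 - x1)) - a1 E * x3 - a3 E))"

definition mordell_weil_group :: "'a::field set \<Rightarrow> 'a weierstrass \<Rightarrow> 'a point monoid" where
  "mordell_weil_group K E =
     \<lparr>carrier = rational_points K E, monoid.mult = point_add E, one = Infinity\<rparr>"


section \<open>Subgroups of a given isomorphism type\<close>

definition has_subgroup_isomorphic_to :: "('a, 'c) monoid_scheme \<Rightarrow> ('b, 'd) monoid_scheme \<Rightarrow> bool"
  where
  "has_subgroup_isomorphic_to G A \<longleftrightarrow> (\<exists>H. subgroup H G \<and> G\<lparr>carrier := H\<rparr> \<cong> A)"

end

theory Submission
  imports Defs "HOL-Number_Theory.Cong"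
begin

text \<open>
  For each group we exhibit a curve \<open>E: y\<^sup>2 = x\<^sup>3 + a x\<^sup>2 + b x + c\<close> over a cubic field \<open>K\<close>
  together with torsion points generating a subgroup \<open>H\<close> that contains the whole 2-torsion of
  \<open>E(K)\<close>, and points of infinite order. Independence is a 2-descent. Call \<open>H\<close> saturated if
  \<open>2x \<in> H\<close> implies \<open>x \<in> H\<close>. If \<open>H\<close> is saturated and no \<open>h + P\<close> with \<open>h \<in> H\<close> lies in \<open>2E(K)\<close>, then \<open>P\<close>
  is free over \<open>H\<close> and \<open>H + \<int> P\<close> is again saturated; only representatives of \<open>h\<close> modulo \<open>2H\<close>
  matter. A point of abscissa \<open>u\<close> in \<open>2E(K)\<close> yields a root in \<open>K\<close> of a monic quartic
  depending on \<open>u\<close>. Such roots are excluded by reduction modulo a prime of degree one of \<open>\<int>[\<alpha>]\<close>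
  at a simple root of the minimal polynomial of \<open>\<alpha>\<close>: there \<open>\<int>[\<alpha>]\<close> is locally integrally closed,
  so that roots in \<open>K\<close> of monic polynomials over \<open>\<int>[\<alpha>]\<close> reduce to roots in the prime field.
\<close>

section \<open>The group law\<close>

definition linear_factor :: "'a::comm_ring_1 \<Rightarrow> 'a poly" where
  "linear_factor r = [:- r, 1:]"

lemma poly_linear_factor [simp]: "poly (linear_factor r) x = x - r"
  by (simp add: linear_factor_def)

lemma linear_factor_nonzero [simp]: "linear_factor r \<noteq> 0"
  by (simp add: linear_factor_def)

lemma degree_linear_factor [simp]: "degree (linear_factor r) = 1"
  by (simp add: linear_factor_def)

lemma degree_linear_factor_mult:
  fixes p :: "'a::idom poly"
  assumes "p \<noteq> 0" shows "degree (linear_factor r * p) = Suc (degree p)"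
  using assms by (subst degree_mult_eq) (simp_all add: linear_factor_def)

lemma linear_factor_dvd_iff: "linear_factor r dvd p \<longleftrightarrow> poly p r = 0"
  by (simp add: linear_factor_def poly_eq_0_iff_dvd)

lemma degree_le_1_poly:
  assumes "degree p \<le> 1" obtains k l where "p = [:k, l:]"
proof
  show "p = [:coeff p 0, coeff p 1:]"
    using assms by (auto simp: poly_eq_iff coeff_pCons coeff_eq_0 split: nat.split)
qed

lemma degree_le_1_root:
  fixes p :: "'a::idom poly"
  assumes "degree p \<le> 1" "poly p r = 0" shows "p = smult (coeff p 1) (linear_factor r)"
proof -
  obtain k l where p: "p = [:k, l:]" using degree_le_1_poly[OF assms(1)] .
  then have "k = - (r * l)" using assms(2) by (simp add: eq_neg_iff_add_eq_0)
  then show ?thesis by (simp add: p linear_factor_def)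
qed

lemma cancel_linear_factor:
  fixes d s u :: "'a::field poly"
  assumes "d * s = linear_factor x * u" and "poly d x = 0 \<or> poly s x \<noteq> 0"
  obtains d' where "d = linear_factor x * d'" and "d' * s = u"
proof -
  have "poly (d * s) x = 0" using assms(1) by simp
  then have "linear_factor x dvd d" using assms(2) by (auto simp: linear_factor_dvd_iff)
  then obtain d' where d: "d = linear_factor x * d'" ..
  then have "linear_factor x * (d' * s) = linear_factor x * u" using assms(1) by (simp add: mult_ac)
  then have "d' * s = u" by simp
  with d show thesis by (rule that)
qed

declare on_curve.simps(2) [simp del] point_add.simps(3) [simp del]

lemma discriminant_short:
  "discriminant (Weierstrass 0 a 0 b c) =
     16 * ((a * b)\<^sup>2 - 4 * b ^ 3 - 4 * (c * a ^ 3) - 27 * c\<^sup>2 + 18 * (c * (a * b)))"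
  by (simp add: discriminant_def b2_def b4_def b6_def b8_def algebra_simps power2_eq_square
      power3_eq_cube)

locale short_weierstrass =
  fixes a b c :: "'a::field"
  assumes discriminant_nonzero: "discriminant (Weierstrass 0 a 0 b c) \<noteq> 0"
begin

abbreviation E :: "'a weierstrass" where "E \<equiv> Weierstrass 0 a 0 b c"

abbreviation point_plus :: "'a point \<Rightarrow> 'a point \<Rightarrow> 'a point" (infixl \<open>\<boxplus>\<close> 65)
  where "P \<boxplus> Q \<equiv> point_add E P Q"

lemma add_Infinity_right [simp]: "P \<boxplus> Infinity = P"
  by (cases P) simp_all

definition cubic :: "'a poly" where "cubic = [:c, b, a, 1:]"

lemma poly_cubic: "poly cubic x = x ^ 3 + a * x\<^sup>2 + b * x + c"
  by (simp add: cubic_def algebra_simps power2_eq_square power3_eq_cube)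

lemma poly_pderiv_cubic: "poly (pderiv cubic) x = 3 * x\<^sup>2 + 2 * a * x + b"
  by (simp add: cubic_def pderiv_pCons algebra_simps power2_eq_square)

lemma on_curve_affine [simp]: "on_curve E (Affine x y) \<longleftrightarrow> y\<^sup>2 = poly cubic x"
  by (simp add: poly_cubic on_curve.simps)

lemma two_nonzero [simp]: "(2 :: 'a) \<noteq> 0"
proof
  assume "(2 :: 'a) = 0"
  moreover have "discriminant E
      = 2 * (8 * ((a * b)\<^sup>2 - 4 * b ^ 3 - 4 * (c * a ^ 3) - 27 * c\<^sup>2 + 18 * (c * (a * b))))"
    by (simp add: discriminant_short)
  ultimately show False using discriminant_nonzero by (simp only: mult_zero_left)
qed

lemma cubic_no_multiple_root:
  assumes "poly cubic x = 0" shows "poly (pderiv cubic) x \<noteq> 0"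
proof
  assume "poly (pderiv cubic) x = 0"
  then have b: "b = - (3 * x\<^sup>2 + 2 * a * x)"
    by (simp only: poly_pderiv_cubic eq_neg_iff_add_eq_0 add.commute)
  have c: "c = - (x ^ 3 + a * x\<^sup>2 + b * x)"
    using assms by (simp only: poly_cubic eq_neg_iff_add_eq_0 add.commute)
  have "discriminant E = 0" unfolding discriminant_short unfolding c unfolding b
    by (simp add: algebra_simps power2_eq_square power3_eq_cube)
  then show False using discriminant_nonzero by simp
qed

definition opposite :: "'a \<times> 'a \<Rightarrow> 'a \<times> 'a \<Rightarrow> bool" where
  "opposite A B \<longleftrightarrow> fst B = fst A \<and> snd B = - snd A"

lemma opposite_commute: "opposite A B \<longleftrightarrow> opposite B A"
  by (auto simp: opposite_def)

lemma add_opposite: "opposite (x1, y1) (x2, y2) \<Longrightarrow> Affine x1 y1 \<boxplus> Affine x2 y2 = Infinity"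
  by (simp add: opposite_def point_add.simps)

lemma not_opposite_same_abscissa:
  assumes "y1\<^sup>2 = poly cubic x" "y2\<^sup>2 = poly cubic x" "\<not> opposite (x, y1) (x, y2)"
  shows "y1 = y2" and "y2 \<noteq> 0"
proof -
  have "y1 = y2 \<or> y1 = - y2" using assms(1,2) by (metis power2_eq_iff)
  then show "y1 = y2" using assms(3) by (auto simp: opposite_def)
  then show "y2 \<noteq> 0" using assms(3) by (auto simp: opposite_def)
qed

definition slope :: "'a \<Rightarrow> 'a \<Rightarrow> 'a \<Rightarrow> 'a \<Rightarrow> 'a" where
  "slope x1 y1 x2 y2 =
     (if x1 = x2 then poly (pderiv cubic) x1 / (2 * y1) else (y2 - y1) / (x2 - x1))"

lemma add_affine:
  assumes "\<not> opposite (x1, y1) (x2, y2)"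
    and "l = slope x1 y1 x2 y2" and "x3 = l\<^sup>2 - a - x1 - x2"
  shows "Affine x1 y1 \<boxplus> Affine x2 y2 = Affine x3 (- (y1 + l * (x3 - x1)))"
  using assms
  by (auto simp: point_add.simps Let_def opposite_def slope_def poly_pderiv_cubic
      eq_neg_iff_add_eq_0 add.commute)

text \<open>
  The line \<open>y = L(x)\<close> meets the curve in the points \<open>A\<close>, \<open>B\<close> and a third point of abscissa \<open>x\<close>,
  with multiplicities.
\<close>

definition chord :: "'a poly \<Rightarrow> 'a \<times> 'a \<Rightarrow> 'a \<times> 'a \<Rightarrow> 'a \<Rightarrow> bool" where
  "chord L A B x \<longleftrightarrow> degree L \<le> 1 \<and> poly L (fst A) = snd A \<and> poly L (fst B) = snd B \<and>
     cubic - L\<^sup>2 = linear_factor (fst A) * (linear_factor (fst B) * linear_factor x)"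

lemma chord_commute: "chord L A B x \<Longrightarrow> chord L B A x"
  by (simp add: chord_def mult.left_commute)

lemma chord_reflect:
  "chord L (x1, y1) (x2, y2) x3 \<Longrightarrow> chord (- L) (x1, - y1) (x3, - poly L x3) x2"
  by (simp add: chord_def mult_ac)

lemma chord_third_on_curve:
  assumes "chord L A B x" shows "(poly L x)\<^sup>2 = poly cubic x"
proof -
  have "poly (cubic - L\<^sup>2) x = 0" using assms by (simp add: chord_def)
  then show ?thesis by simp
qed

lemma chord_coefficients:
  "cubic - [:k, l:]\<^sup>2 = linear_factor x1 * (linear_factor x2 * linear_factor x3) \<longleftrightarrow>
     c - k\<^sup>2 = - (x1 * x2 * x3) \<and> b - 2 * k * l = x1 * x2 + x1 * x3 + x2 * x3 \<and>
     a - l\<^sup>2 = - x1 - x2 - x3"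
  by (auto simp: cubic_def linear_factor_def power2_eq_square algebra_simps)

lemma add_chord:
  assumes chord: "chord L (x1, y1) (x2, y2) x3" and nopp: "\<not> opposite (x1, y1) (x2, y2)"
  shows "Affine x1 y1 \<boxplus> Affine x2 y2 = Affine x3 (- poly L x3)"
proof -
  obtain k l where L: "L = [:k, l:]"
    using chord degree_le_1_poly unfolding chord_def by blast
  have y: "y1 = k + l * x1" "y2 = k + l * x2"
    using chord by (auto simp: chord_def L)
  have lin: "b - 2 * k * l = x1 * x2 + x1 * x3 + x2 * x3" and quad: "a - l\<^sup>2 = - x1 - x2 - x3"
    using chord unfolding chord_def L fst_conv chord_coefficients by blast+
  from quad have x3: "l\<^sup>2 - a - x1 - x2 = x3" by (simp add: algebra_simps)
  have "slope x1 y1 x2 y2 = l"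
  proof (cases "x1 = x2")
    case True
    then have "y1 = y2" using y by simp
    then have "2 * y1 \<noteq> 0" using True nopp by (auto simp: opposite_def)
    moreover have "3 * x1\<^sup>2 + 2 * a * x1 + b = l * (2 * y1)"
      using lin True by (simp add: y x3[symmetric] algebra_simps power2_eq_square)
    ultimately show ?thesis using True by (simp add: slope_def poly_pderiv_cubic)
  next
    case False
    then show ?thesis by (simp add: slope_def y field_simps)
  qed
  then have "Affine x1 y1 \<boxplus> Affine x2 y2 = Affine x3 (- (y1 + l * (x3 - x1)))"
    using x3 by (intro add_affine[OF nopp]) simp_all
  then show ?thesis by (simp add: L y algebra_simps)
qed

lemma slope_line:
  assumes A: "y1\<^sup>2 = poly cubic x1" and B: "y2\<^sup>2 = poly cubic x2"
    and nopp: "\<not> opposite (x1, y1) (x2, y2)"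
    and l: "l = slope x1 y1 x2 y2" and k: "k = y1 - l * x1" and x3: "x3 = l\<^sup>2 - a - x1 - x2"
  shows "y2 = k + l * x2 \<and> b - 2 * k * l = x1 * x2 + x1 * x3 + x2 * x3"
proof (cases "x1 = x2")
  case True
  then have "y1 = y2" "y2 \<noteq> 0" using A B nopp not_opposite_same_abscissa by metis+
  then have "l * (2 * y1) = 3 * x1\<^sup>2 + 2 * a * x1 + b"
    using True by (simp add: l slope_def poly_pderiv_cubic)
  then show ?thesis
    using True \<open>y1 = y2\<close> by (simp add: k x3 algebra_simps power2_eq_square)
next
  case False
  then have "l * (x2 - x1) = y2 - y1" by (simp add: l slope_def)
  then have y2: "y2 = k + l * x2" by (simp add: k algebra_simps)
  have "(x2 - x1) * (b - 2 * k * l - (x1 * x2 + x1 * x3 + x2 * x3))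
    = (poly cubic x2 - (k + l * x2)\<^sup>2) - (poly cubic x1 - y1\<^sup>2)"
    by (simp add: poly_cubic k x3 algebra_simps power2_eq_square power3_eq_cube)
  also have "\<dots> = 0" using A B y2 by simp
  finally show ?thesis using False y2 by simp
qed

lemma chord_exists:
  assumes A: "y1\<^sup>2 = poly cubic x1" and B: "y2\<^sup>2 = poly cubic x2"
    and nopp: "\<not> opposite (x1, y1) (x2, y2)"
  shows "\<exists>L x3. chord L (x1, y1) (x2, y2) x3"
proof -
  define l where "l = slope x1 y1 x2 y2"
  define k where "k = y1 - l * x1"
  define x3 where "x3 = l\<^sup>2 - a - x1 - x2"
  have y2: "y2 = k + l * x2" and linear: "b - 2 * k * l = x1 * x2 + x1 * x3 + x2 * x3"
    using slope_line[OF A B nopp l_def k_def x3_def] by blast+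
  have "c - k\<^sup>2 + x1 * x2 * x3
    = (poly cubic x1 - y1\<^sup>2) - x1 * (b - 2 * k * l - (x1 * x2 + x1 * x3 + x2 * x3))"
    by (simp add: poly_cubic k_def x3_def algebra_simps power2_eq_square power3_eq_cube)
  also have "\<dots> = 0" using A linear by simp
  finally have "c - k\<^sup>2 = - (x1 * x2 * x3)" by (simp add: eq_neg_iff_add_eq_0)
  then have "cubic - [:k, l:]\<^sup>2 = linear_factor x1 * (linear_factor x2 * linear_factor x3)"
    using linear unfolding chord_coefficients by (simp add: x3_def)
  moreover have "y1 = k + l * x1" by (simp add: k_def)
  ultimately have "chord [:k, l:] (x1, y1) (x2, y2) x3"
    using y2 by (simp add: chord_def mult.commute)
  then show ?thesis by blast
qed

lemma obtain_chord:
  assumes "on_curve E (Affine x1 y1)" "on_curve E (Affine x2 y2)" "\<not> opposite (x1, y1) (x2, y2)"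
  obtains L x3 where "chord L (x1, y1) (x2, y2) x3"
    and "Affine x1 y1 \<boxplus> Affine x2 y2 = Affine x3 (- poly L x3)"
  using assms chord_exists add_chord unfolding on_curve_affine by metis

lemma on_curve_add:
  assumes "on_curve E P" "on_curve E Q" shows "on_curve E (P \<boxplus> Q)"
proof (cases P; cases Q)
  fix x1 y1 x2 y2 assume PQ: "P = Affine x1 y1" "Q = Affine x2 y2"
  show ?thesis
  proof (cases "opposite (x1, y1) (x2, y2)")
    case True then show ?thesis by (simp add: PQ add_opposite opposite_commute)
  next
    case False
    then obtain L x3 where "chord L (x1, y1) (x2, y2) x3" "P \<boxplus> Q = Affine x3 (- poly L x3)"
      using assms obtain_chord unfolding PQ by blast
    then show ?thesis by (simp add: chord_third_on_curve)
  qed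
qed (use assms in auto)

lemma add_commute:
  assumes "on_curve E P" "on_curve E Q" shows "P \<boxplus> Q = Q \<boxplus> P"
proof (cases P; cases Q)
  fix x1 y1 x2 y2 assume PQ: "P = Affine x1 y1" "Q = Affine x2 y2"
  show ?thesis
  proof (cases "opposite (x1, y1) (x2, y2)")
    case True then show ?thesis by (simp add: PQ add_opposite opposite_commute)
  next
    case False
    then show ?thesis using assms unfolding PQ
      by (metis obtain_chord add_chord chord_commute opposite_commute)
  qed
qed auto

lemma add_cancel_opposite:
  assumes A: "on_curve E (Affine x1 y1)" and C: "on_curve E C"
  shows "Affine x1 (- y1) \<boxplus> (Affine x1 y1 \<boxplus> C) = C"
proof (cases C)
  case (Affine x2 y2)
  show ?thesis
  proof (cases "opposite (x1, y1) (x2, y2)")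
    case True
    then show ?thesis by (simp add: Affine add_opposite) (simp add: opposite_def)
  next
    case False
    obtain L x3 where chord: "chord L (x1, y1) (x2, y2) x3"
      and sum: "Affine x1 y1 \<boxplus> C = Affine x3 (- poly L x3)"
      using obtain_chord A C False unfolding Affine by metis
    have "\<not> opposite (x1, - y1) (x3, - poly L x3)"
    proof
      assume "opposite (x1, - y1) (x3, - poly L x3)"
      then have "x3 = x1" "poly L x1 = 0" and "y1 = 0"
        using chord by (auto simp: opposite_def chord_def eq_neg_iff_add_eq_0)
      then have "cubic = L\<^sup>2 + linear_factor x1 * (linear_factor x1 * linear_factor x2)"
        using chord by (simp add: chord_def mult_ac diff_eq_eq add.commute)
      then have "poly (pderiv cubic) x1 = 0"
        using \<open>poly L x1 = 0\<close> by (simp add: pderiv_add pderiv_mult power2_eq_square)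
      moreover have "poly cubic x1 = 0" using A \<open>y1 = 0\<close> by simp
      ultimately show False using cubic_no_multiple_root by blast
    qed
    moreover have "poly L x2 = y2" using chord by (simp add: chord_def)
    ultimately show ?thesis using add_chord[OF chord_reflect[OF chord]] sum Affine by simp
  qed
qed (simp add: add_opposite opposite_def)

text \<open>
  Associativity: three points \<open>A\<close>, \<open>B\<close>, \<open>C\<close> in general position lie on a unique graph \<open>y = q(x)\<close>
  with \<open>q\<close> of degree at most two that touches the curve at coinciding points. The curve meets
  this graph in one further point, the negative of \<open>(A + B) + C\<close>, and this description does not
  depend on the order of the summands.
\<close>

definition interpolates ::
  "'a poly \<Rightarrow> 'a poly \<Rightarrow> 'a \<times> 'a \<Rightarrow> 'a \<times> 'a \<Rightarrow> 'a \<times> 'a \<Rightarrow> bool" where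
  "interpolates q r A B C \<longleftrightarrow> degree q \<le> 2 \<and>
     poly q (fst A) = snd A \<and> poly q (fst B) = snd B \<and> poly q (fst C) = snd C \<and>
     cubic - q\<^sup>2 = linear_factor (fst A) * (linear_factor (fst B) * (linear_factor (fst C) * r))"

definition residual_point :: "'a poly \<Rightarrow> 'a poly \<Rightarrow> 'a point" where
  "residual_point q r =
     (if degree r = 0 then Infinity
      else let x = - coeff r 0 / coeff r 1 in Affine x (- poly q x))"

lemma interpolates_rotate: "interpolates q r A B C \<Longrightarrow> interpolates q r B C A"
  unfolding interpolates_def by (simp only: mult_ac)

lemma interpolates_of_chord:
  assumes "chord L A B (fst C)" and "snd C = poly L (fst C)"
  shows "interpolates L 1 A B C" and "residual_point L 1 = Infinity"
  using assms by (auto simp: chord_def interpolates_def residual_point_def)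

lemma chords_sum_difference:
  assumes L: "chord L A B x3" and M: "chord M (x3, - poly L x3) C x5"
    and nopp: "\<not> opposite A C" "\<not> opposite B C"
  obtains k where "k \<noteq> 0" and "M + L = smult k (linear_factor x3)"
    and "smult k (M - L) = linear_factor (fst A) * linear_factor (fst B)
      - linear_factor (fst C) * linear_factor x5"
proof -
  define k where "k = coeff (M + L) 1"
  have sum: "M + L = smult k (linear_factor x3)"
  proof -
    have "degree (M + L) \<le> 1" using L M by (intro degree_add_le) (auto simp: chord_def)
    moreover have "poly (M + L) x3 = 0" using M by (simp add: chord_def)
    ultimately show ?thesis unfolding k_def by (rule degree_le_1_root)
  qed
  have "linear_factor x3 * smult k (M - L) = (M + L) * (M - L)" unfolding sum by simp
  also have "\<dots> = (cubic - L\<^sup>2) - (cubic - M\<^sup>2)" by (simp add: algebra_simps power2_eq_square)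
  also have "\<dots> = linear_factor x3 * (linear_factor (fst A) * linear_factor (fst B)
      - linear_factor (fst C) * linear_factor x5)"
    using L M unfolding chord_def by (simp add: algebra_simps)
  finally have diff: "smult k (M - L) = linear_factor (fst A) * linear_factor (fst B)
      - linear_factor (fst C) * linear_factor x5"
    by (simp only: mult_cancel_left linear_factor_nonzero simp_thms)
  have "k \<noteq> 0"
  proof
    assume "k = 0"
    then have "linear_factor (fst A) * linear_factor (fst B)
        = linear_factor (fst C) * linear_factor x5" and "M = - L"
      using diff sum by (auto simp: eq_neg_iff_add_eq_0)
    then have "poly (linear_factor (fst A) * linear_factor (fst B)) (fst C) = 0" by simp
    then show False using nopp L M \<open>M = - L\<close> by (auto simp: chord_def opposite_def)
  qed
  with sum diff show thesis by (intro that)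
qed

lemma interpolates_of_chords:
  assumes L: "chord L A B x3" and M: "chord M (x3, - poly L x3) C x5"
    and nopp: "\<not> opposite A C" "\<not> opposite B C"
  shows "\<exists>q r. interpolates q r A B C \<and> residual_point q r = Affine x5 (- poly M x5)"
proof -
  define D where "D = linear_factor (fst A) * linear_factor (fst B)"
  define F where "F = linear_factor (fst C) * linear_factor x5"
  obtain k where "k \<noteq> 0" and sum: "M + L = smult k (linear_factor x3)"
    and diff: "smult k (M - L) = D - F"
    using chords_sum_difference[OF assms] unfolding D_def F_def .
  define w where "w = 1 / k"
  have "w \<noteq> 0" and wk: "smult w (smult k p) = p" for p
    using \<open>k \<noteq> 0\<close> by (simp_all add: w_def)
  define q where "q = L + smult w D"
  define r where "r = smult (- (w\<^sup>2)) (linear_factor x5)"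
  have x3: "linear_factor x3 = smult w (M + L)" using wk[of "linear_factor x3"] sum by simp
  have M_eq: "M = L + smult w (D - F)" using wk[of "M - L"] diff by simp
  then have q: "q = M + smult w F" by (simp add: q_def smult_diff_right)
  have "cubic - q\<^sup>2 = D * smult w (M + L) + L\<^sup>2 - q\<^sup>2"
    using L by (simp add: chord_def D_def diff_eq_eq mult_ac flip: x3)
  also have "\<dots> = - smult (w\<^sup>2) (D * F)"
    unfolding q_def M_eq
    by (simp add: algebra_simps power2_eq_square smult_add_right smult_diff_right)
  also have "\<dots> = linear_factor (fst A) * (linear_factor (fst B) * (linear_factor (fst C) * r))"
    by (simp add: D_def F_def r_def mult_ac)
  finally have "cubic - q\<^sup>2
    = linear_factor (fst A) * (linear_factor (fst B) * (linear_factor (fst C) * r))" .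
  moreover have "degree q \<le> 2"
    using L unfolding q_def D_def chord_def
    by (intro degree_add_le order.trans[OF degree_smult_le]) (auto simp: degree_linear_factor_mult)
  moreover have "poly q (fst A) = snd A" "poly q (fst B) = snd B"
    using L by (simp_all add: q_def D_def chord_def)
  moreover have "poly q (fst C) = snd C"
    using M by (simp add: q F_def chord_def)
  ultimately have "interpolates q r A B C" unfolding interpolates_def by blast
  moreover have "poly q x5 = poly M x5" by (simp add: q F_def)
  then have "residual_point q r = Affine x5 (- poly M x5)"
    using \<open>w \<noteq> 0\<close> by (simp add: residual_point_def r_def linear_factor_def)
  ultimately show ?thesis by blast
qed

lemma add_add_eq_residual_point:
  assumes A: "on_curve E (Affine x1 y1)" and B: "on_curve E (Affine x2 y2)"
    and C: "on_curve E (Affine x3 y3)"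
    and nopp: "\<not> opposite (x1, y1) (x2, y2)" "\<not> opposite (x2, y2) (x3, y3)"
      "\<not> opposite (x1, y1) (x3, y3)"
  shows "\<exists>q r. interpolates q r (x1, y1) (x2, y2) (x3, y3) \<and>
    Affine x1 y1 \<boxplus> Affine x2 y2 \<boxplus> Affine x3 y3 = residual_point q r"
proof -
  obtain L x4 where L: "chord L (x1, y1) (x2, y2) x4"
    and sum: "Affine x1 y1 \<boxplus> Affine x2 y2 = Affine x4 (- poly L x4)"
    using obtain_chord[OF A B nopp(1)] .
  show ?thesis
  proof (cases "opposite (x4, - poly L x4) (x3, y3)")
    case True
    then have "chord L (x1, y1) (x2, y2) (fst (x3, y3))" "snd (x3, y3) = poly L (fst (x3, y3))"
      using L by (simp_all add: opposite_def)
    then show ?thesis using interpolates_of_chord True sum by (metis add_opposite)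
  next
    case False
    have "on_curve E (Affine x4 (- poly L x4))" using A B sum by (metis on_curve_add)
    then obtain M x5 where "chord M (x4, - poly L x4) (x3, y3) x5"
      "Affine x4 (- poly L x4) \<boxplus> Affine x3 y3 = Affine x5 (- poly M x5)"
      using obtain_chord C False by blast
    then show ?thesis using interpolates_of_chords[OF L _ nopp(3,2)] sum by metis
  qed
qed

lemma interpolates_unique:
  assumes i: "interpolates q r A B C" and i': "interpolates q' r' A B C"
    and nopp: "\<not> opposite A B" "\<not> opposite B C" "\<not> opposite A C"
    and curve: "(snd A)\<^sup>2 = poly cubic (fst A)" "(snd B)\<^sup>2 = poly cubic (fst B)"
      "(snd C)\<^sup>2 = poly cubic (fst C)"
  shows "q = q'" and "r = r'"
proof -
  define d s where "d = q' - q" and "s = q' + q"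
  have "d * s = (cubic - q\<^sup>2) - (cubic - q'\<^sup>2)"
    by (simp add: d_def s_def algebra_simps power2_eq_square)
  then have ds: "d * s
      = linear_factor (fst A) * (linear_factor (fst B) * (linear_factor (fst C) * (r - r')))"
    using i i' by (simp only: interpolates_def right_diff_distrib)
  have s: "poly s (fst P) = snd P + snd P" and d: "poly d (fst P) = 0" if "P \<in> {A, B, C}" for P
    using i i' that by (auto simp: interpolates_def d_def s_def)
  have unramified: "poly s (fst Q) \<noteq> 0"
    if "fst P = fst Q" "P \<in> {A, B, C}" "Q \<in> {A, B, C}" "\<not> opposite P Q" for P Q
    using not_opposite_same_abscissa[of "snd P" "fst Q" "snd Q"] curve s that
    unfolding opposite_def by auto
  have "poly d (fst A) = 0 \<or> poly s (fst A) \<noteq> 0" using d by simp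
  then obtain d1 where d1: "d = linear_factor (fst A) * d1"
    and ds1: "d1 * s = linear_factor (fst B) * (linear_factor (fst C) * (r - r'))"
    by (rule cancel_linear_factor[OF ds])
  have "poly d1 (fst B) = 0 \<or> poly s (fst B) \<noteq> 0"
    using d[of B] unramified[of A B] nopp by (auto simp: d1)
  then obtain d2 where d2: "d1 = linear_factor (fst B) * d2"
    and ds2: "d2 * s = linear_factor (fst C) * (r - r')"
    by (rule cancel_linear_factor[OF ds1])
  have "poly d2 (fst C) = 0 \<or> poly s (fst C) \<noteq> 0"
    using d[of C] unramified[of A C] unramified[of B C] nopp by (auto simp: d1 d2)
  then obtain d3 where d3: "d2 = linear_factor (fst C) * d3" and ds3: "d3 * s = r - r'"
    by (rule cancel_linear_factor[OF ds2])
  have "d3 = 0"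
  proof (rule ccontr)
    assume "d3 \<noteq> 0"
    then have "degree d \<ge> 3" unfolding d1 d2 d3 by (simp add: degree_linear_factor_mult)
    moreover have "degree d \<le> 2"
      using i i' unfolding d_def interpolates_def by (intro degree_diff_le) auto
    ultimately show False by simp
  qed
  then show "q = q'" "r = r'" using d1 d2 d3 ds3 by (simp_all add: d_def)
qed

lemma add_add_of_opposite:
  assumes opp: "opposite (x1, y1) (x2, y2)" and A: "A = Affine x1 y1" "on_curve E A"
    and B: "B = Affine x2 y2" "on_curve E B" and C: "on_curve E C"
  shows "A \<boxplus> B \<boxplus> C = C" and "B \<boxplus> C \<boxplus> A = C" and "C \<boxplus> A \<boxplus> B = C"
proof -
  have neg: "A = Affine x2 (- y2)" "B = Affine x1 (- y1)"
    using opp A(1) B(1) by (simp_all add: opposite_def)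
  show "A \<boxplus> B \<boxplus> C = C" using add_opposite[OF opp] A(1) B(1) by simp
  have "B \<boxplus> C \<boxplus> A = A \<boxplus> (B \<boxplus> C)" by (intro add_commute on_curve_add A(2) B(2) C)
  also have "\<dots> = C" using add_cancel_opposite[of x2 y2 C] B C by (simp only: neg(1))
  finally show "B \<boxplus> C \<boxplus> A = C" .
  have "C \<boxplus> A \<boxplus> B = B \<boxplus> (C \<boxplus> A)" by (intro add_commute on_curve_add A(2) B(2) C)
  also have "\<dots> = B \<boxplus> (A \<boxplus> C)" using add_commute[OF A(2) C] by simp
  also have "\<dots> = C" using add_cancel_opposite[of x1 y1 C] A C by (simp only: neg(2))
  finally show "C \<boxplus> A \<boxplus> B = C" .
qed

lemma add_rotate:
  assumes A: "A = Affine x1 y1" "on_curve E A" and B: "B = Affine x2 y2" "on_curve E B"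
    and C: "C = Affine x3 y3" "on_curve E C"
  shows "A \<boxplus> B \<boxplus> C = B \<boxplus> C \<boxplus> A"
proof -
  consider (AB) "opposite (x1, y1) (x2, y2)" | (BC) "opposite (x2, y2) (x3, y3)"
    | (CA) "opposite (x3, y3) (x1, y1)"
    | (none) "\<not> opposite (x1, y1) (x2, y2)" "\<not> opposite (x2, y2) (x3, y3)"
        "\<not> opposite (x3, y3) (x1, y1)"
    by blast
  then show ?thesis
  proof cases
    case AB
    show ?thesis using add_add_of_opposite(1,2)[OF AB A B C(2)] by simp
  next
    case BC
    show ?thesis using add_add_of_opposite(3,1)[OF BC B C A(2)] by simp
  next
    case CA
    show ?thesis using add_add_of_opposite(2,3)[OF CA C A B(2)] by simp
  next
    case none
    have sym: "\<not> opposite (x1, y1) (x3, y3)" "\<not> opposite (x2, y2) (x1, y1)"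
      using none opposite_commute by blast+
    obtain q r where qr: "interpolates q r (x1, y1) (x2, y2) (x3, y3)"
      "A \<boxplus> B \<boxplus> C = residual_point q r"
      using add_add_eq_residual_point[of x1 y1 x2 y2 x3 y3] A B C none sym by blast
    obtain q' r' where qr': "interpolates q' r' (x2, y2) (x3, y3) (x1, y1)"
      "B \<boxplus> C \<boxplus> A = residual_point q' r'"
      using add_add_eq_residual_point[of x2 y2 x3 y3 x1 y1] A B C none sym by blast
    have "q = q'" "r = r'"
      using interpolates_unique[OF interpolates_rotate[OF qr(1)] qr'(1)] none sym A B C by simp_all
    then show ?thesis using qr(2) qr'(2) by simp
  qed
qed

lemma add_assoc:
  assumes "on_curve E A" "on_curve E B" "on_curve E C"
  shows "A \<boxplus> B \<boxplus> C = A \<boxplus> (B \<boxplus> C)"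
proof (cases A; cases B; cases C)
  fix x1 y1 x2 y2 x3 y3 assume "A = Affine x1 y1" "B = Affine x2 y2" "C = Affine x3 y3"
  then have "A \<boxplus> B \<boxplus> C = B \<boxplus> C \<boxplus> A" using assms by (intro add_rotate)
  then show ?thesis using add_commute[of "B \<boxplus> C" A] on_curve_add assms by simp
qed auto

end

section \<open>Saturated subgroups of abelian groups\<close>

context comm_group
begin

lemma mult_mem_subgroup_iff:
  assumes "subgroup H G" "x \<in> carrier G" "h \<in> H" shows "x \<otimes> h \<in> H \<longleftrightarrow> x \<in> H"
proof
  interpret H: subgroup H G by fact
  show "x \<otimes> h \<in> H" if "x \<in> H" using that assms(3) by (rule H.m_closed)
  assume "x \<otimes> h \<in> H"
  then have "x \<otimes> h \<otimes> inv h \<in> H" using assms(3) by simp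
  then show "x \<in> H" using assms by (simp add: m_assoc H.mem_carrier)
qed

definition doubles :: "'a set" where
  "doubles = (\<lambda>x. x \<otimes> x) ` carrier G"

lemma subgroup_doubles: "subgroup doubles G"
proof (rule subgroupI)
  show "doubles \<subseteq> carrier G" by (auto simp: doubles_def)
  show "doubles \<noteq> {}" by (auto simp: doubles_def)
next
  fix x assume "x \<in> doubles"
  then obtain u where "u \<in> carrier G" "x = u \<otimes> u" by (auto simp: doubles_def)
  then show "inv x \<in> doubles" by (auto simp: doubles_def inv_mult)
next
  fix x y assume "x \<in> doubles" "y \<in> doubles"
  then obtain u v where "u \<in> carrier G" "x = u \<otimes> u" "v \<in> carrier G" "y = v \<otimes> v"
    by (auto simp: doubles_def)
  then have "x \<otimes> y = (u \<otimes> v) \<otimes> (u \<otimes> v)" "u \<otimes> v \<in> carrier G" by (simp_all add: m_ac)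
  then show "x \<otimes> y \<in> doubles" by (auto simp: doubles_def)
qed

lemma int_pow_double: "x \<in> carrier G \<Longrightarrow> x [^] (2 * k :: int) = x [^] k \<otimes> x [^] k"
  by (simp only: mult_2 int_pow_mult)

lemma int_pow_even_in_doubles: "x \<in> carrier G \<Longrightarrow> x [^] (2 * k :: int) \<in> doubles"
  by (auto simp: doubles_def int_pow_double)

lemma mult_int_pow_in_doubles_iff:
  assumes "x \<in> carrier G" "y \<in> carrier G"
  shows "y \<otimes> x [^] (k::int) \<in> doubles \<longleftrightarrow> (if even k then y else y \<otimes> x) \<in> doubles"
proof -
  obtain l :: int where "y \<otimes> x [^] k = (if even k then y else y \<otimes> x) \<otimes> x [^] (2 * l)"
  proof (cases "even k")
    case True
    then obtain l where "k = 2 * l" by (rule evenE)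
    with True show thesis by (intro that) simp
  next
    case False
    then obtain l where "k = 2 * l + 1" by (rule oddE)
    then have "y \<otimes> x [^] k = y \<otimes> x \<otimes> x [^] (2 * l)" using assms by (simp add: int_pow_mult m_ac)
    with False show thesis by (intro that) simp
  qed
  then show ?thesis
    using assms mult_mem_subgroup_iff[OF subgroup_doubles _ int_pow_even_in_doubles] by simp
qed

lemma mult_odd_pow_in_doubles_iff:
  assumes "x \<in> carrier G" "y \<in> carrier G" "odd n"
  shows "y \<otimes> x [^] (n::nat) \<in> doubles \<longleftrightarrow> y \<otimes> x \<in> doubles"
  using mult_int_pow_in_doubles_iff[of x y "int n"] assms by (simp add: int_pow_int)

lemma square_mult_inv:
  "x \<in> carrier G \<Longrightarrow> y \<in> carrier G \<Longrightarrow>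
    (x \<otimes> inv y) \<otimes> (x \<otimes> inv y) = (x \<otimes> x) \<otimes> inv (y \<otimes> y)"
  by (simp add: inv_mult m_ac)

abbreviation powers :: "'a \<Rightarrow> 'a set" where
  "powers x \<equiv> range (\<lambda>k::int. x [^] k)"

lemma nat_pow_in_powers: "x [^] (n::nat) \<in> powers x"
  by (auto simp flip: int_pow_int)

lemma nat_pow_binary:
  assumes "x \<in> carrier G"
  shows "x [^] (numeral (num.Bit0 n) :: nat) = x [^] (numeral n :: nat) \<otimes> x [^] (numeral n :: nat)"
    and "x [^] (numeral (num.Bit1 n) :: nat) =
      x [^] (numeral n :: nat) \<otimes> x [^] (numeral n :: nat) \<otimes> x"
  using assms
  by (simp_all only: numeral_Bit0 numeral_Bit1 nat_pow_mult nat_pow_eone flip: nat_pow_mult)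

lemma ord_eqI:
  assumes "x \<in> carrier G" "n > 0" "x [^] n = \<one>" "x \<noteq> \<one>"
    and "list_all (\<lambda>d. d dvd n \<longrightarrow> x [^] d \<noteq> \<one>) [2..<n]"
  shows "ord x = n"
proof (rule ccontr)
  assume "ord x \<noteq> n"
  moreover have "ord x dvd n" using assms(1,3) pow_eq_id by simp
  moreover have "ord x \<noteq> 1" using assms(1,4) ord_eq_1 by blast
  moreover have "ord x > 0" "ord x \<le> n" using calculation(2) assms(2)
    by (auto intro: dvd_imp_le Nat.gr0I)
  ultimately show False using assms(1,5) by (auto simp: list_all_iff)
qed

definition two_saturated :: "'a set \<Rightarrow> bool" where
  "two_saturated H \<longleftrightarrow> subgroup H G \<and> (\<forall>x\<in>carrier G. x \<otimes> x \<in> H \<longrightarrow> x \<in> H)"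

lemma two_saturated_subgroup: "two_saturated H \<Longrightarrow> subgroup H G"
  and two_saturatedD: "two_saturated H \<Longrightarrow> x \<in> carrier G \<Longrightarrow> x \<otimes> x \<in> H \<Longrightarrow> x \<in> H"
  unfolding two_saturated_def by blast+

lemma two_saturatedI:
  assumes H: "subgroup H G"
    and two_torsion: "\<And>x. x \<in> carrier G \<Longrightarrow> x \<otimes> x = \<one> \<Longrightarrow> x \<in> H"
    and doubles: "\<And>h. h \<in> H \<Longrightarrow> h \<in> doubles \<Longrightarrow> \<exists>y\<in>H. h = y \<otimes> y"
  shows "two_saturated H"
  unfolding two_saturated_def
proof (intro conjI ballI impI H)
  interpret H: subgroup H G by (rule H)
  fix x assume x: "x \<in> carrier G" "x \<otimes> x \<in> H"
  then obtain y where y: "y \<in> H" "x \<otimes> x = y \<otimes> y" using doubles by (auto simp: doubles_def)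
  then have "x \<otimes> inv y \<in> H"
    using x by (intro two_torsion) (simp_all add: square_mult_inv H.mem_carrier)
  then show "x \<in> H" using x y mult_mem_subgroup_iff[OF H] by (simp add: H.mem_carrier)
qed

lemma power_in_two_saturated:
  assumes H: "two_saturated H" and p: "p \<in> carrier G"
    and indep: "\<And>h. h \<in> H \<Longrightarrow> h \<otimes> p \<notin> doubles"
  shows "p [^] (k::int) \<in> H \<Longrightarrow> k = 0"
proof (induction "nat \<bar>k\<bar>" arbitrary: k rule: less_induct)
  case less
  interpret H: subgroup H G using H by (rule two_saturated_subgroup)
  show ?case
  proof (cases "even k")
    case True
    then obtain l where l: "k = 2 * l" by (rule evenE)
    then have "p [^] l \<otimes> p [^] l \<in> H" using less.prems p by (simp add: int_pow_double)
    then have pl: "p [^] l \<in> H" using two_saturatedD[OF H] p by blast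
    show ?thesis
    proof (rule ccontr)
      assume "k \<noteq> 0"
      then have "nat \<bar>l\<bar> < nat \<bar>k\<bar>" using l by linarith
      then have "l = 0" using pl by (rule less.hyps)
      then show False using \<open>k \<noteq> 0\<close> l by simp
    qed
  next
    case False
    have "inv (p [^] k) \<otimes> p [^] k = \<one>" using p by simp
    then have "inv (p [^] k) \<otimes> p [^] k \<in> doubles"
      using subgroup.one_closed[OF subgroup_doubles] by metis
    then have "inv (p [^] k) \<otimes> p \<in> doubles"
      using p False mult_int_pow_in_doubles_iff[of p "inv (p [^] k)" k] by simp
    then show ?thesis using indep[OF H.m_inv_closed[OF less.prems]] by blast
  qed
qed

lemma two_saturated_adjoin:
  assumes H: "two_saturated H" and p: "p \<in> carrier G"
    and indep: "\<And>h. h \<in> H \<Longrightarrow> h \<otimes> p \<notin> doubles"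
  shows "two_saturated (H <#> powers p)"
proof -
  interpret H: subgroup H G using H by (rule two_saturated_subgroup)
  have "x \<in> H <#> powers p" if x: "x \<in> carrier G" "x \<otimes> x \<in> H <#> powers p" for x
  proof -
    obtain h and k :: int where h: "h \<in> H" and eq: "x \<otimes> x = h \<otimes> p [^] k"
      using x(2) by (auto simp: set_mult_def)
    have "h \<otimes> p [^] k \<in> doubles"
      unfolding doubles_def using x(1) eq by (intro image_eqI[of _ _ x]) simp_all
    then have "(if even k then h else h \<otimes> p) \<in> doubles"
      using mult_int_pow_in_doubles_iff[OF p H.mem_carrier[OF h]] by blast
    then have "even k" using indep[OF h] by presburger
    then obtain l where "k = 2 * l" by (rule evenE)
    then have "x \<otimes> x = h \<otimes> (p [^] l \<otimes> p [^] l)" using eq p by (simp add: int_pow_double)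
    moreover have "(x \<otimes> inv (p [^] l)) \<otimes> (x \<otimes> inv (p [^] l))
        = (x \<otimes> x) \<otimes> inv (p [^] l \<otimes> p [^] l)"
      using x(1) p by (intro square_mult_inv) simp_all
    ultimately have "(x \<otimes> inv (p [^] l)) \<otimes> (x \<otimes> inv (p [^] l)) = h"
      using p H.mem_carrier[OF h]
      by (simp only: m_assoc r_inv m_closed int_pow_closed inv_closed r_one)
    then have "x \<otimes> inv (p [^] l) \<in> H"
      using two_saturatedD[OF H, of "x \<otimes> inv (p [^] l)"] h x(1) p by simp
    then have "x \<otimes> inv (p [^] l) \<otimes> p [^] l \<in> H <#> powers p" by (auto simp: set_mult_def)
    moreover have "x \<otimes> inv (p [^] l) \<otimes> p [^] l = x" using x(1) p by (simp add: m_assoc)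
    ultimately show ?thesis by (simp only:)
  qed
  moreover have "subgroup (H <#> powers p) G"
    by (rule mult_subgroups[OF H.subgroup_axioms subgroup_of_powers[OF p]])
  ultimately show ?thesis unfolding two_saturated_def by blast
qed

lemma odd_order_power_eq_double:
  assumes "t \<in> carrier G" "odd (ord t)" "h \<in> powers t"
  obtains y where "y \<in> powers t" and "h = y \<otimes> y"
proof -
  obtain i :: int where i: "h = t [^] i" using assms(3) by blast
  obtain l where "ord t = 2 * l + 1" using assms(2) by (rule oddE)
  then have "2 * ((int l + 1) * i) - i = int (ord t) * i" by (simp add: algebra_simps)
  then have "h = t [^] (2 * ((int l + 1) * i))"
    using assms(1) i by (simp only: int_pow_eq) simp
  then have "h = t [^] ((int l + 1) * i) \<otimes> t [^] ((int l + 1) * i)"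
    using assms(1) by (simp only: int_pow_double)
  then show thesis by (intro that) auto
qed

lemma two_saturated_powers_odd:
  assumes t: "t \<in> carrier G" and odd: "odd (ord t)"
    and two_torsion: "\<And>x. x \<in> carrier G \<Longrightarrow> x \<otimes> x = \<one> \<Longrightarrow> x = \<one>"
  shows "two_saturated (powers t)"
proof (rule two_saturatedI[OF subgroup_of_powers[OF t]])
  show "x \<in> powers t" if "x \<in> carrier G" "x \<otimes> x = \<one>" for x
    using two_torsion[OF that] subgroup.one_closed[OF subgroup_of_powers[OF t]] by simp
  show "\<exists>y\<in>powers t. h = y \<otimes> y" if "h \<in> powers t" for h
    using odd_order_power_eq_double[OF t odd that] by blast
qed

lemma two_saturated_powers:
  assumes t: "t \<in> carrier G" and "t \<notin> doubles"
    and two_torsion: "\<And>x. x \<in> carrier G \<Longrightarrow> x \<otimes> x = \<one> \<Longrightarrow> x \<in> powers t"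
  shows "two_saturated (powers t)"
proof (rule two_saturatedI[OF subgroup_of_powers[OF t] two_torsion])
  show "\<exists>y\<in>powers t. h = y \<otimes> y" if "h \<in> powers t" "h \<in> doubles" for h
  proof -
    obtain i :: int where i: "h = t [^] i" using \<open>h \<in> powers t\<close> by blast
    then have "even i"
      using mult_int_pow_in_doubles_iff[of t \<one> i] that t \<open>t \<notin> doubles\<close> by (auto split: if_splits)
    then obtain l where "i = 2 * l" by (rule evenE)
    then show ?thesis using t i by (auto simp: int_pow_double)
  qed
qed

lemma mult_int_pows_in_doubles_iff:
  assumes "s \<in> carrier G" "t \<in> carrier G" "x \<in> carrier G"
  shows "x \<otimes> (s [^] (i::int) \<otimes> t [^] (j::int)) \<in> doubles \<longleftrightarrow>
    x \<otimes> ((if even i then \<one> else s) \<otimes> (if even j then \<one> else t)) \<in> doubles"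
proof -
  define e where "e = (if even j then \<one> else t)"
  have e: "e \<in> carrier G" using assms by (simp add: e_def)
  have "x \<otimes> (s [^] i \<otimes> t [^] j) \<in> doubles \<longleftrightarrow> x \<otimes> s [^] i \<otimes> e \<in> doubles"
    using assms mult_int_pow_in_doubles_iff[of t "x \<otimes> s [^] i" j] by (simp add: e_def m_assoc)
  also have "x \<otimes> s [^] i \<otimes> e = x \<otimes> e \<otimes> s [^] i" using assms e by (simp add: m_ac)
  also have "\<dots> \<in> doubles \<longleftrightarrow> x \<otimes> ((if even i then \<one> else s) \<otimes> e) \<in> doubles"
    using assms e mult_int_pow_in_doubles_iff[of s "x \<otimes> e" i] by (simp add: m_ac)
  finally show ?thesis by (simp add: e_def)
qed

lemma two_saturated_powers_mult_powers:
  assumes s: "s \<in> carrier G" and t: "t \<in> carrier G"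
    and indep: "s \<notin> doubles" "t \<notin> doubles" "s \<otimes> t \<notin> doubles"
    and two_torsion: "\<And>x. x \<in> carrier G \<Longrightarrow> x \<otimes> x = \<one> \<Longrightarrow> x \<in> powers s <#> powers t"
  shows "two_saturated (powers s <#> powers t)"
proof (rule two_saturatedI[OF _ two_torsion])
  show "subgroup (powers s <#> powers t) G"
    using s t by (intro mult_subgroups subgroup_of_powers)
  show "\<exists>y\<in>powers s <#> powers t. h = y \<otimes> y"
    if "h \<in> powers s <#> powers t" and "h \<in> doubles" for h
  proof -
    obtain i j :: int where ij: "h = s [^] i \<otimes> t [^] j" using \<open>h \<in> powers s <#> powers t\<close>
      by (auto simp: set_mult_def)
    then have "even i" "even j"
      using that(2) mult_int_pows_in_doubles_iff[OF s t one_closed, of i j] indep s t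
      by (auto split: if_splits)
    then obtain k l where "i = 2 * k" "j = 2 * l" by (meson evenE)
    then have "h = (s [^] k \<otimes> t [^] l) \<otimes> (s [^] k \<otimes> t [^] l)"
      using ij s t by (simp add: int_pow_double m_ac)
    then show ?thesis unfolding set_mult_def by blast
  qed
qed

lemma has_subgroup_isomorphic_to_of_mon:
  assumes "group A" "h \<in> mon A G" shows "has_subgroup_isomorphic_to G A"
proof -
  have hom: "h \<in> hom A G" and inj: "inj_on h (carrier A)" using assms(2) by (simp_all add: mon_def)
  interpret hom: group_hom A G h
    using assms(1) hom by (simp add: group_hom_def group_hom_axioms_def is_group)
  have "h \<in> iso A (G\<lparr>carrier := h ` carrier A\<rparr>)"
    using inj hom by (auto simp: iso_def hom_def bij_betw_def)
  then have "G\<lparr>carrier := h ` carrier A\<rparr> \<cong> A" by (intro group.iso_sym[OF assms(1)] is_isoI)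
  then show ?thesis unfolding has_subgroup_isomorphic_to_def using hom.img_is_subgroup by blast
qed

lemma has_subgroup_isomorphic_to_DirProd_assoc:
  assumes "has_subgroup_isomorphic_to G ((A \<times>\<times> B) \<times>\<times> C)"
  shows "has_subgroup_isomorphic_to G (A \<times>\<times> B \<times>\<times> C)"
proof -
  have "(\<lambda>((x, y), z). (x, (y, z))) \<in> iso ((A \<times>\<times> B) \<times>\<times> C) (A \<times>\<times> B \<times>\<times> C)"
    by (auto simp: iso_def hom_def inj_on_def bij_betw_def image_iff)
  then show ?thesis
    using assms unfolding has_subgroup_isomorphic_to_def by (meson is_isoI iso_trans)
qed

lemma int_pow_mod_ord:
  assumes "t \<in> carrier G" shows "t [^] (k mod int (ord t)) = t [^] (k::int)"
  using assms by (simp add: int_pow_eq flip: minus_mod_eq_mult_div)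

lemma int_pow_mon_integer_mod_group:
  assumes "t \<in> carrier G" shows "(\<lambda>k::int. t [^] k) \<in> mon (integer_mod_group (ord t)) G"
proof -
  have "(\<lambda>k::int. t [^] k) \<in> hom (integer_mod_group (ord t)) G"
    using assms by (auto simp: hom_def int_pow_mult int_pow_mod_ord)
  moreover have "k = 0" if "k \<in> carrier (integer_mod_group (ord t))" "t [^] k = \<one>" for k :: int
    using that assms by (auto simp: int_pow_eq_id carrier_integer_mod_group zdvd_not_zless
        split: if_splits dest: zdvd_imp_le)
  ultimately show ?thesis by (simp add: mon_iff_hom_one is_group)
qed

lemma int_pow_mon_integer_group:
  assumes "p \<in> carrier G" "\<And>k::int. p [^] k = \<one> \<Longrightarrow> k = 0"
  shows "(\<lambda>k::int. p [^] k) \<in> mon integer_group G"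
  using assms hom_integer_group_pow by (auto simp: mon_iff_hom_one is_group)

lemma mult_mon_DirProd:
  assumes A: "group A" "g \<in> mon A G" and B: "group B" "h \<in> mon B G"
    and disjoint: "\<And>a b. a \<in> carrier A \<Longrightarrow> b \<in> carrier B \<Longrightarrow> g a \<otimes> h b = \<one> \<Longrightarrow> g a = \<one>"
  shows "(\<lambda>(a, b). g a \<otimes> h b) \<in> mon (A \<times>\<times> B) G"
proof -
  have gh: "g \<in> hom A G" "h \<in> hom B G" using A B by (simp_all add: mon_def)
  then have "(\<lambda>x. (g \<circ> fst) x \<otimes> (h \<circ> snd) x) \<in> hom (A \<times>\<times> B) G"
    using A B by (intro hom_group_mult) (simp_all only: hom_of_fst hom_of_snd)
  moreover have "a = \<one>\<^bsub>A\<^esub> \<and> b = \<one>\<^bsub>B\<^esub>"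
    if "a \<in> carrier A" "b \<in> carrier B" "g a \<otimes> h b = \<one>" for a b
    using that disjoint[OF that] A B gh[THEN hom_in_carrier]
    by (auto simp: mon_iff_hom_one is_group)
  ultimately show ?thesis
    using A B by (auto simp: mon_iff_hom_one is_group DirProd_group case_prod_unfold)
qed

lemma adjoin_mon:
  assumes A: "group A" "g \<in> mon A G" and H: "two_saturated (g ` carrier A)"
    and p: "p \<in> carrier G" and indep: "\<And>h. h \<in> g ` carrier A \<Longrightarrow> h \<otimes> p \<notin> doubles"
  shows "(\<lambda>(a, k). g a \<otimes> p [^] k) \<in> mon (A \<times>\<times> integer_group) G"
proof (rule mult_mon_DirProd[OF A group_integer_group])
  interpret H: subgroup "g ` carrier A" G using H by (rule two_saturated_subgroup)
  have no_power: "k = 0" if "p [^] k \<in> g ` carrier A" for k :: int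
    using power_in_two_saturated[OF H p indep that] .
  then show "(\<lambda>k. p [^] k) \<in> mon integer_group G"
    using p H.one_closed by (intro int_pow_mon_integer_group) auto
  fix a and k :: int assume a: "a \<in> carrier A" and eq: "g a \<otimes> p [^] k = \<one>"
  then have ga: "g a \<in> g ` carrier A" "g a \<in> carrier G" by (auto dest: H.mem_carrier)
  then have "p [^] k = inv (g a)" using eq p by (metis int_pow_closed inv_equality m_comm)
  then have "k = 0" using no_power ga(1) by simp
  then show "g a = \<one>" using eq ga(2) by simp
qed

lemma has_subgroup_isomorphic_to_adjoin:
  assumes "group A" "g \<in> mon A G" "two_saturated (g ` carrier A)"
    and "p \<in> carrier G" "\<And>h. h \<in> g ` carrier A \<Longrightarrow> h \<otimes> p \<notin> doubles"
  shows "has_subgroup_isomorphic_to G (A \<times>\<times> integer_group)"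
  by (rule has_subgroup_isomorphic_to_of_mon[OF _ adjoin_mon[OF assms]])
    (simp add: DirProd_group assms(1))

lemma image_mult_DirProd:
  "(\<lambda>(a, b). g a \<otimes> h b) ` carrier (A \<times>\<times> B) = g ` carrier A <#> h ` carrier B"
  by (auto simp: set_mult_def)

lemma image_int_pow_integer_mod_group:
  assumes "t \<in> carrier G"
  shows "(\<lambda>k. t [^] k) ` carrier (integer_mod_group (ord t)) = powers t"
proof -
  have "t [^] k \<in> (\<lambda>k. t [^] k) ` carrier (integer_mod_group (ord t))" for k :: int
    using assms
    by (intro image_eqI[of _ _ "k mod int (ord t)"])
      (auto simp: int_pow_mod_ord carrier_integer_mod_group)
  then show ?thesis by auto
qed

lemma mult_in_doubles_iff_of_odd_order:
  assumes "t \<in> carrier G" "odd (ord t)" "h \<in> powers t" "x \<in> carrier G"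
  shows "h \<otimes> x \<in> doubles \<longleftrightarrow> x \<in> doubles"
proof -
  obtain y where "y \<in> powers t" "h = y \<otimes> y"
    using odd_order_power_eq_double[OF assms(1-3)] .
  then have h: "h \<in> carrier G" "h \<in> doubles" using assms(1) by (auto simp: doubles_def)
  then have "h \<otimes> x = x \<otimes> h" using assms(4) by (simp add: m_comm)
  then show ?thesis using mult_mem_subgroup_iff[OF subgroup_doubles assms(4) h(2)] by simp
qed

theorem has_subgroup_odd_cyclic_times_int:
  assumes t: "t \<in> carrier G" and odd: "odd (ord t)" and p: "p \<in> carrier G" "p \<notin> doubles"
    and two_torsion: "\<And>x. x \<in> carrier G \<Longrightarrow> x \<otimes> x = \<one> \<Longrightarrow> x = \<one>"
  shows "has_subgroup_isomorphic_to G (integer_mod_group (ord t) \<times>\<times> integer_group)"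
proof (rule has_subgroup_isomorphic_to_adjoin)
  show "(\<lambda>i. t [^] i) \<in> mon (integer_mod_group (ord t)) G"
    by (rule int_pow_mon_integer_mod_group[OF t])
  show "two_saturated ((\<lambda>i. t [^] i) ` carrier (integer_mod_group (ord t)))"
    unfolding image_int_pow_integer_mod_group[OF t]
    by (rule two_saturated_powers_odd[OF t odd two_torsion])
  show "h \<otimes> p \<notin> doubles" if "h \<in> (\<lambda>i. t [^] i) ` carrier (integer_mod_group (ord t))" for h
    using mult_in_doubles_iff_of_odd_order[OF t odd] p that by blast
qed (simp_all add: p)

theorem has_subgroup_odd_cyclic_times_int_int:
  assumes t: "t \<in> carrier G" and odd: "odd (ord t)" and p: "p \<in> carrier G" and q: "q \<in> carrier G"
    and indep: "p \<notin> doubles" "q \<notin> doubles" "p \<otimes> q \<notin> doubles"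
    and two_torsion: "\<And>x. x \<in> carrier G \<Longrightarrow> x \<otimes> x = \<one> \<Longrightarrow> x = \<one>"
  shows "has_subgroup_isomorphic_to G
    (integer_mod_group (ord t) \<times>\<times> integer_group \<times>\<times> integer_group)"
proof (rule has_subgroup_isomorphic_to_DirProd_assoc, rule has_subgroup_isomorphic_to_adjoin)
  let ?A = "integer_mod_group (ord t) \<times>\<times> integer_group" and ?g = "\<lambda>(i, k). t [^] i \<otimes> p [^] k"
  have saturated: "two_saturated (powers t)" using two_saturated_powers_odd[OF t odd two_torsion] .
  have indep_p: "h \<otimes> p \<notin> doubles" if "h \<in> powers t" for h
    using mult_in_doubles_iff_of_odd_order[OF t odd that p] indep by blast
  have "h \<otimes> p \<notin> doubles" if "h \<in> (\<lambda>i. t [^] i) ` carrier (integer_mod_group (ord t))" for h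
    using that unfolding image_int_pow_integer_mod_group[OF t] by (rule indep_p)
  moreover have "two_saturated ((\<lambda>i. t [^] i) ` carrier (integer_mod_group (ord t)))"
    unfolding image_int_pow_integer_mod_group[OF t] by (rule saturated)
  ultimately show "?g \<in> mon ?A G"
    by (intro adjoin_mon int_pow_mon_integer_mod_group[OF t] group_integer_mod_group p)
  have image: "?g ` carrier ?A = powers t <#> powers p"
    unfolding image_mult_DirProd image_int_pow_integer_mod_group[OF t] by simp
  show "two_saturated (?g ` carrier ?A)"
    unfolding image by (rule two_saturated_adjoin[OF saturated p indep_p])
  show "h \<otimes> q \<notin> doubles" if "h \<in> ?g ` carrier ?A" for h
  proof -
    obtain u and k :: int where u: "u \<in> powers t" "h = u \<otimes> p [^] k"
      using \<open>h \<in> ?g ` carrier ?A\<close> by (auto simp: image set_mult_def)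
    then have "h \<otimes> q = u \<otimes> (q \<otimes> p [^] k)" using t p q by (auto simp: m_ac)
    then show ?thesis
      using mult_in_doubles_iff_of_odd_order[OF t odd u(1), of "q \<otimes> p [^] k"]
        mult_int_pow_in_doubles_iff[of p q k] p q indep by (simp add: m_comm)
  qed
qed (simp_all add: q DirProd_group)

theorem has_subgroup_cyclic_times_int:
  assumes t: "t \<in> carrier G" and p: "p \<in> carrier G"
    and indep: "t \<notin> doubles" "p \<notin> doubles" "p \<otimes> t \<notin> doubles"
    and two_torsion: "\<And>x. x \<in> carrier G \<Longrightarrow> x \<otimes> x = \<one> \<Longrightarrow> x \<in> powers t"
  shows "has_subgroup_isomorphic_to G (integer_mod_group (ord t) \<times>\<times> integer_group)"
proof (rule has_subgroup_isomorphic_to_adjoin)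
  show "(\<lambda>i. t [^] i) \<in> mon (integer_mod_group (ord t)) G"
    by (rule int_pow_mon_integer_mod_group[OF t])
  show "two_saturated ((\<lambda>i. t [^] i) ` carrier (integer_mod_group (ord t)))"
    unfolding image_int_pow_integer_mod_group[OF t]
    by (rule two_saturated_powers[OF t indep(1) two_torsion])
  show "h \<otimes> p \<notin> doubles" if "h \<in> (\<lambda>i. t [^] i) ` carrier (integer_mod_group (ord t))" for h
  proof -
    have "h \<in> powers t" using that unfolding image_int_pow_integer_mod_group[OF t] .
    then obtain k :: int where "h = t [^] k" by blast
    then show ?thesis
      using mult_int_pow_in_doubles_iff[of t p k] t p indep by (simp add: m_comm)
  qed
qed (simp_all add: p)

theorem has_subgroup_two_times_cyclic_times_int:
  assumes s: "s \<in> carrier G" "s \<otimes> s = \<one>" and t: "t \<in> carrier G" and p: "p \<in> carrier G"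
    and indep_st: "s \<notin> doubles" "t \<notin> doubles" "s \<otimes> t \<notin> doubles"
    and indep_p: "p \<notin> doubles" "p \<otimes> s \<notin> doubles" "p \<otimes> t \<notin> doubles" "p \<otimes> s \<otimes> t \<notin> doubles"
    and two_torsion: "\<And>x. x \<in> carrier G \<Longrightarrow> x \<otimes> x = \<one> \<Longrightarrow> x \<in> powers s <#> powers t"
  shows "has_subgroup_isomorphic_to G
    (integer_mod_group 2 \<times>\<times> integer_mod_group (ord t) \<times>\<times> integer_group)"
proof (rule has_subgroup_isomorphic_to_DirProd_assoc, rule has_subgroup_isomorphic_to_adjoin)
  let ?A = "integer_mod_group 2 \<times>\<times> integer_mod_group (ord t)" and ?g = "\<lambda>(i, j). s [^] i \<otimes> t [^] j"
  have "\<one> \<in> doubles" by (rule subgroup.one_closed[OF subgroup_doubles])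
  then have "s \<noteq> \<one>" using indep_st(1) by metis
  then have ord_s: "ord s = 2" using s by (intro ord_eqI) (auto simp: numeral_2_eq_2)
  show "?g \<in> mon ?A G"
  proof (rule mult_mon_DirProd)
    show "(\<lambda>i. s [^] i) \<in> mon (integer_mod_group 2) G"
      using int_pow_mon_integer_mod_group[OF s(1)] ord_s by simp
    fix i j :: int assume "s [^] i \<otimes> t [^] j = \<one>"
    then have "even i"
      using mult_int_pows_in_doubles_iff[OF s(1) t one_closed, of i j] indep_st s t \<open>\<one> \<in> doubles\<close>
      by (auto split: if_splits)
    then show "s [^] i = \<one>" using s ord_s by (simp add: int_pow_eq_id)
  qed (simp_all add: int_pow_mon_integer_mod_group[OF t])
  have image: "?g ` carrier ?A = powers s <#> powers t"
    using image_int_pow_integer_mod_group[OF s(1)] image_int_pow_integer_mod_group[OF t]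
    by (simp only: image_mult_DirProd ord_s)
  show "two_saturated (?g ` carrier ?A)"
    unfolding image by (rule two_saturated_powers_mult_powers[OF s(1) t indep_st two_torsion])
  show "h \<otimes> p \<notin> doubles" if "h \<in> ?g ` carrier ?A" for h
  proof -
    obtain i j :: int where "h = s [^] i \<otimes> t [^] j" using \<open>h \<in> ?g ` carrier ?A\<close>
      by (auto simp: image set_mult_def)
    then have "h \<otimes> p = p \<otimes> (s [^] i \<otimes> t [^] j)" using s t p by (simp add: m_comm)
    then show ?thesis
      using mult_int_pows_in_doubles_iff[OF s(1) t p, of i j] s t p indep_p
      by (auto simp: m_assoc split: if_splits)
  qed
qed (simp_all add: p DirProd_group)

corollary has_subgroup_two_times_cyclic_times_int_odd_power:
  assumes s: "s \<in> carrier G" "s \<otimes> s = \<one>" and t: "t \<in> carrier G" and p: "p \<in> carrier G"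
    and k: "odd k" "t [^] (k::nat) = u"
    and indep_su: "s \<notin> doubles" "u \<notin> doubles" "s \<otimes> u \<notin> doubles"
    and indep_p: "p \<notin> doubles" "p \<otimes> s \<notin> doubles" "p \<otimes> u \<notin> doubles" "p \<otimes> s \<otimes> u \<notin> doubles"
    and two_torsion: "\<And>x. x \<in> carrier G \<Longrightarrow> x \<otimes> x = \<one> \<Longrightarrow> x \<in> powers s <#> powers t"
  shows "has_subgroup_isomorphic_to G
    (integer_mod_group 2 \<times>\<times> integer_mod_group (ord t) \<times>\<times> integer_group)"
proof (rule has_subgroup_two_times_cyclic_times_int[OF s t p])
  have odd_power: "x \<otimes> u \<in> doubles \<longleftrightarrow> x \<otimes> t \<in> doubles" if "x \<in> carrier G" for x
    using mult_odd_pow_in_doubles_iff[OF t that k(1)] k(2) by simp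
  have "u \<in> carrier G" using t k(2) by auto
  then show "t \<notin> doubles" using odd_power[of \<one>] indep_su t by simp
  show "s \<otimes> t \<notin> doubles" "p \<otimes> t \<notin> doubles" "p \<otimes> s \<otimes> t \<notin> doubles"
    using odd_power[of s] odd_power[of p] odd_power[of "p \<otimes> s"] indep_su indep_p s p by simp_all
qed (fact indep_su indep_p two_torsion)+

end

section \<open>The Mordell--Weil group\<close>

lemma ring_of_type_algebra_simps [simp]:
  "carrier ring_of_type_algebra = UNIV"
  "x \<otimes>\<^bsub>ring_of_type_algebra\<^esub> y = x * y" "\<one>\<^bsub>ring_of_type_algebra\<^esub> = 1"
  "x \<oplus>\<^bsub>ring_of_type_algebra\<^esub> y = x + y" "\<zero>\<^bsub>ring_of_type_algebra\<^esub> = 0"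
  by (simp_all add: ring_of_type_algebra_def)

lemma a_inv_ring_of_type_algebra [simp]: "\<ominus>\<^bsub>ring_of_type_algebra\<^esub> x = - (x :: 'a::field)"
proof -
  interpret field "ring_of_type_algebra :: 'a ring" by (rule field_from_type_algebra)
  show ?thesis by (rule minus_equality) simp_all
qed

lemma m_inv_ring_of_type_algebra [simp]:
  assumes "x \<noteq> 0" shows "inv\<^bsub>ring_of_type_algebra\<^esub> x = inverse (x :: 'a::field)"
proof -
  interpret field "ring_of_type_algebra :: 'a ring" by (rule field_from_type_algebra)
  show ?thesis using assms comm_inv_char[of x "inverse x"] by simp
qed

context
  fixes K :: "'a::field set"
  assumes K: "subfield K (ring_of_type_algebra :: 'a ring)"
begin

lemma
  shows subfield_zero: "0 \<in> K" and subfield_one: "1 \<in> K"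
    and subfield_add: "x \<in> K \<Longrightarrow> y \<in> K \<Longrightarrow> x + y \<in> K"
    and subfield_minus: "x \<in> K \<Longrightarrow> - x \<in> K"
    and subfield_mult: "x \<in> K \<Longrightarrow> y \<in> K \<Longrightarrow> x * y \<in> K"
  using subringE[OF subfieldE(1)[OF K]] by simp_all

lemma subfield_diff: "x \<in> K \<Longrightarrow> y \<in> K \<Longrightarrow> x - y \<in> K"
  using subfield_add[of x "- y"] subfield_minus by simp

lemma subfield_power: "x \<in> K \<Longrightarrow> x ^ n \<in> K"
  by (induction n) (simp_all add: subfield_one subfield_mult)

lemma subfield_numeral: "numeral n \<in> K"
  by (induction n) (simp_all only: numeral.simps subfield_one subfield_add)

lemma subfield_divide:
  assumes "x \<in> K" "y \<in> K" shows "x / y \<in> K"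
proof (cases "y = 0")
  case False
  interpret field "ring_of_type_algebra :: 'a ring" by (rule field_from_type_algebra)
  have "inverse y \<in> K" using subfield_m_inv(1)[OF K, of y] assms False by simp
  then show ?thesis using assms by (simp add: divide_inverse subfield_mult)
qed (simp add: subfield_zero)

end

lemmas subfield_intros = subfield_zero subfield_one subfield_numeral subfield_add subfield_diff
  subfield_minus subfield_mult subfield_divide subfield_power

definition halving_poly :: "'a::comm_ring_1 \<Rightarrow> 'a \<Rightarrow> 'a \<Rightarrow> 'a \<Rightarrow> 'a poly" where
  "halving_poly a b c u =
     [:b\<^sup>2 - 4 * (c * (u + a)), - (4 * (2 * c + b * u)), - (2 * (b + 2 * (a * u))), - (4 * u), 1:]"

locale short_weierstrass_over = short_weierstrass +
  fixes K :: "'a set"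
  assumes subfield: "subfield K (ring_of_type_algebra :: 'a ring)"
    and coefficients_in_K: "a \<in> K" "b \<in> K" "c \<in> K"
begin

abbreviation G :: "'a point monoid" where "G \<equiv> mordell_weil_group K E"

lemmas K_closed = coefficients_in_K subfield_intros[OF subfield]

lemma elliptic_curve: "elliptic_curve_over K E"
  using discriminant_nonzero by (simp add: elliptic_curve_over_def K_closed)

lemma carrier_G: "P \<in> carrier G \<longleftrightarrow> on_curve E P \<and> set_point P \<subseteq> K"
  by (simp add: mordell_weil_group_def rational_points_def)

lemma affine_in_carrier_iff: "Affine x y \<in> carrier G \<longleftrightarrow> y\<^sup>2 = poly cubic x \<and> x \<in> K \<and> y \<in> K"
  by (simp add: carrier_G)

lemma mult_G [simp]: "P \<otimes>\<^bsub>G\<^esub> Q = P \<boxplus> Q" and one_G [simp]: "\<one>\<^bsub>G\<^esub> = Infinity"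
  by (simp_all add: mordell_weil_group_def)

lemma point_add_rational:
  assumes "set_point P \<subseteq> K" "set_point Q \<subseteq> K" shows "set_point (P \<boxplus> Q) \<subseteq> K"
proof (cases P; cases Q)
  fix x1 y1 x2 y2 assume PQ: "P = Affine x1 y1" "Q = Affine x2 y2"
  show ?thesis
  proof (cases "opposite (x1, y1) (x2, y2)")
    case False
    have "slope x1 y1 x2 y2 \<in> K"
      using assms PQ by (auto simp: slope_def poly_pderiv_cubic intro!: K_closed)
    then show ?thesis
      using assms PQ by (auto simp: add_affine[OF False refl refl] intro!: K_closed)
  qed (simp add: PQ add_opposite)
qed (use assms in auto)

sublocale MW: comm_group G
proof (rule comm_groupI)
  fix P Q R assume "P \<in> carrier G" "Q \<in> carrier G" "R \<in> carrier G"
  then show "P \<otimes>\<^bsub>G\<^esub> Q \<otimes>\<^bsub>G\<^esub> R = P \<otimes>\<^bsub>G\<^esub> (Q \<otimes>\<^bsub>G\<^esub> R)"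
    by (simp add: carrier_G add_assoc)
next
  fix P Q assume "P \<in> carrier G" "Q \<in> carrier G"
  then show "P \<otimes>\<^bsub>G\<^esub> Q \<in> carrier G" and "P \<otimes>\<^bsub>G\<^esub> Q = Q \<otimes>\<^bsub>G\<^esub> P"
    using add_commute by (simp_all add: carrier_G on_curve_add point_add_rational)
next
  fix P assume P: "P \<in> carrier G"
  show "\<exists>Q\<in>carrier G. Q \<otimes>\<^bsub>G\<^esub> P = \<one>\<^bsub>G\<^esub>"
  proof (cases P)
    case Infinity then show ?thesis using P by (intro bexI[of _ P]) auto
  next
    case (Affine x y)
    then show ?thesis using P
      by (intro bexI[of _ "Affine x (- y)"])
        (auto simp: affine_in_carrier_iff K_closed add_opposite opposite_def)
  qed
qed (auto simp: carrier_G)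

lemma add_eq_Infinity_iff: "Affine x y1 \<boxplus> Affine x y2 = Infinity \<longleftrightarrow> y1 + y2 = 0"
  by (simp add: point_add.simps Let_def)

lemma add_affine_eq_iff:
  assumes "\<not> opposite (x1, y1) (x2, y2)" and slope: "slope x1 y1 x2 y2 = n / d" and "d \<noteq> 0"
  shows "Affine x1 y1 \<boxplus> Affine x2 y2 = Affine x3 y3 \<longleftrightarrow>
    (x1 + x2 + x3 + a) * d\<^sup>2 = n\<^sup>2 \<and> (y1 + y3) * d = n * (x1 - x3)"
proof -
  have "Affine x1 y1 \<boxplus> Affine x2 y2 = Affine x3 y3 \<longleftrightarrow>
      x3 = (n / d)\<^sup>2 - a - x1 - x2 \<and> y3 = - (y1 + n / d * (x3 - x1))"
    using add_affine[OF assms(1) refl refl] by (auto simp: slope)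
  also have "\<dots> \<longleftrightarrow> (x1 + x2 + x3 + a) * d\<^sup>2 = n\<^sup>2 \<and> (y1 + y3) * d = n * (x1 - x3)"
    using \<open>d \<noteq> 0\<close> by (auto simp: field_simps)
  finally show ?thesis .
qed

lemma add_eq_iff:
  "x1 \<noteq> x2 \<Longrightarrow> Affine x1 y1 \<boxplus> Affine x2 y2 = Affine x3 y3 \<longleftrightarrow>
    (x1 + x2 + x3 + a) * (x2 - x1)\<^sup>2 = (y2 - y1)\<^sup>2 \<and> (y1 + y3) * (x2 - x1) = (y2 - y1) * (x1 - x3)"
  by (rule add_affine_eq_iff) (auto simp: opposite_def slope_def)

lemma double_eq_iff:
  "y \<noteq> 0 \<Longrightarrow> Affine x y \<boxplus> Affine x y = Affine x3 y3 \<longleftrightarrow>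
    (x + x + x3 + a) * (2 * y)\<^sup>2 = (3 * x\<^sup>2 + 2 * a * x + b)\<^sup>2 \<and>
    (y + y3) * (2 * y) = (3 * x\<^sup>2 + 2 * a * x + b) * (x - x3)"
  by (rule add_affine_eq_iff)
    (simp_all add: opposite_def slope_def poly_pderiv_cubic eq_neg_iff_add_eq_0)

lemma double_eq_Infinity_iff:
  assumes "on_curve E P"
  shows "P \<boxplus> P = Infinity \<longleftrightarrow> P = Infinity \<or> (\<exists>x. P = Affine x 0 \<and> poly cubic x = 0)"
proof (cases P)
  case (Affine x y)
  then show ?thesis using assms by (cases "y = 0") (auto simp: point_add.simps Let_def)
qed simp

lemma half_is_root:
  assumes "on_curve E P" "P \<boxplus> P = Affine u v"
  shows "\<exists>x y. P = Affine x y \<and> poly (halving_poly a b c u) x = 0"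
proof -
  obtain x y where P: "P = Affine x y" using assms(2) by (cases P) auto
  then have y: "y\<^sup>2 = poly cubic x" and "y \<noteq> 0"
    using assms by (auto simp: add_opposite opposite_def)
  have "poly (halving_poly a b c u) x
    = (3 * x\<^sup>2 + 2 * a * x + b)\<^sup>2 - (x + x + u + a) * (4 * poly cubic x)"
    by (simp add: halving_poly_def poly_cubic algebra_simps power2_eq_square power3_eq_cube)
  also have "\<dots> = 0"
    using assms(2) double_eq_iff[OF \<open>y \<noteq> 0\<close>, of x u v]
    by (simp add: P y[symmetric] power_mult_distrib)
  finally show ?thesis using P by blast
qed

lemma not_in_doubles:
  assumes "\<And>x. x \<in> K \<Longrightarrow> poly (halving_poly a b c u) x \<noteq> 0"
  shows "Affine u v \<notin> MW.doubles"
proof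
  assume "Affine u v \<in> MW.doubles"
  then obtain P where "P \<in> carrier G" "P \<boxplus> P = Affine u v" by (auto simp: MW.doubles_def)
  then show False using half_is_root assms by (fastforce simp: carrier_G)
qed

lemma two_torsionE:
  assumes "P \<in> carrier G" "P \<otimes>\<^bsub>G\<^esub> P = \<one>\<^bsub>G\<^esub>"
  obtains "P = \<one>\<^bsub>G\<^esub>" | x where "x \<in> K" "P = Affine x 0" "poly cubic x = 0"
  using assms double_eq_Infinity_iff by (auto simp: carrier_G)

end

section \<open>Cubic number fields\<close>

lemma (in field) finite_dimension_imp_subfield:
  assumes K: "subfield K R" and F: "subring F R" "K \<subseteq> F" and "finite_dimension K F"
  shows "subfield F R"
proof (rule subfieldI'[OF F(1)])
  fix x assume x: "x \<in> F - {\<zero>}"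
  then have carrier: "x \<in> carrier R" using subringE(1)[OF F(1)] by blast
  have "(algebraic over K) x" using finite_dimension_imp_algebraic[OF K F(1) assms(4)] x by blast
  then have L: "subfield (simple_extension K x) R"
    using simple_extension_is_subfield[OF K carrier] by blast
  have "x \<in> simple_extension K x" by (rule simple_extension_mem[OF subfieldE(1)[OF K] carrier])
  then have "inv x \<in> simple_extension K x" using subfield_m_inv(1)[OF L] x by blast
  then show "inv x \<in> F" using simple_extension_subring_incl[OF F] x by blast
qed

type_synonym quadratic = "int \<times> int \<times> int"

fun qeval :: "quadratic \<Rightarrow> 'a::comm_ring_1 \<Rightarrow> 'a" where
  "qeval (k0, k1, k2) x = of_int k0 + of_int k1 * x + of_int k2 * x\<^sup>2"

declare qeval.simps [simp del]

fun qadd :: "quadratic \<Rightarrow> quadratic \<Rightarrow> quadratic" where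
  "qadd (k0, k1, k2) (l0, l1, l2) = (k0 + l0, k1 + l1, k2 + l2)"

fun qscale :: "int \<Rightarrow> quadratic \<Rightarrow> quadratic" where
  "qscale n (k0, k1, k2) = (n * k0, n * k1, n * k2)"

text \<open>The product modulo \<open>X\<^sup>3 - m\<close>.\<close>

fun qmult :: "quadratic \<Rightarrow> quadratic \<Rightarrow> quadratic \<Rightarrow> quadratic" where
  "qmult (m0, m1, m2) (k0, k1, k2) (l0, l1, l2) =
     (let d = k1 * l2 + k2 * l1; e = k2 * l2 in
      (k0 * l0 + m0 * d + m0 * m2 * e,
       k0 * l1 + k1 * l0 + m1 * d + (m0 + m1 * m2) * e,
       k0 * l2 + k1 * l1 + k2 * l0 + m2 * d + (m1 + m2\<^sup>2) * e))"

lemma qeval_add: "qeval g x + qeval h x = qeval (qadd g h) x"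
  by (cases g; cases h) (simp add: qeval.simps algebra_simps)

lemma qeval_scale: "of_int n * qeval g x = qeval (qscale n g) x"
  by (cases g) (simp add: qeval.simps algebra_simps)

lemma qeval_mult_cofactor:
  fixes x :: "'a::comm_ring_1"
  obtains q where "qeval g x * qeval h x = qeval (qmult m g h) x + q * (x ^ 3 - qeval m x)"
proof -
  obtain m0 m1 m2 k0 k1 k2 l0 l1 l2 where "m = (m0, m1, m2)" "g = (k0, k1, k2)" "h = (l0, l1, l2)"
    by (cases m; cases g; cases h)
  then have "qeval g x * qeval h x = qeval (qmult m g h) x
      + (of_int (k1 * l2 + k2 * l1 + k2 * l2 * m2) + of_int (k2 * l2) * x) * (x ^ 3 - qeval m x)"
    by (simp add: qeval.simps Let_def algebra_simps power2_eq_square power3_eq_cube)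
  then show thesis by (rule that)
qed

locale cubic_field =
  fixes m :: quadratic and \<alpha> :: complex
  assumes root: "\<alpha> ^ 3 = qeval m \<alpha>" and no_integer_root: "n ^ 3 \<noteq> qeval m (n::int)"
begin

lemma qeval_mult: "qeval g \<alpha> * qeval h \<alpha> = qeval (qmult m g h) \<alpha>"
  by (rule qeval_mult_cofactor[of g \<alpha> h m]) (simp add: root)

definition K :: "complex set" where
  "K = {z. \<exists>x\<in>\<rat>. \<exists>y\<in>\<rat>. \<exists>w\<in>\<rat>. z = x + y * \<alpha> + w * \<alpha>\<^sup>2}"

lemma no_rational_root:
  assumes "r \<in> \<rat>" shows "r ^ 3 \<noteq> qeval m (r::complex)"
proof
  assume r: "r ^ 3 = qeval m r"
  obtain m0 m1 m2 where m: "m = (m0, m1, m2)" by (cases m)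
  define p :: "complex poly" where "p = [:- of_int m0, - of_int m1, - of_int m2, 1:]"
  have "algebraic_int r"
  proof
    show "lead_coeff p = 1" by (simp add: p_def)
    show "\<forall>i. coeff p i \<in> \<int>" by (auto simp: p_def coeff_pCons split: nat.split)
    show "poly p r = 0"
      using r by (simp add: p_def m qeval.simps algebra_simps power2_eq_square power3_eq_cube)
  qed
  then obtain n where "r = of_int n"
    using assms rational_algebraic_int_is_int by (auto elim: Ints_cases)
  then have "(of_int (n ^ 3) :: complex) = of_int (qeval m n)" using r by (simp add: m qeval.simps)
  then show False using no_integer_root[of n] by (simp only: of_int_eq_iff)
qed

lemma alpha_irrational: "\<alpha> \<notin> \<rat>"
  using no_rational_root root by blast

lemma alpha_not_quadratic:
  assumes uv: "u \<in> \<rat>" "v \<in> \<rat>" shows "\<alpha>\<^sup>2 \<noteq> u * \<alpha> + v"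
proof
  assume sq: "\<alpha>\<^sup>2 = u * \<alpha> + v"
  obtain m0 m1 m2 where m: "m = (m0, m1, m2)" by (cases m)
  define s t where "s = u\<^sup>2 + v - m1 - m2 * u" and "t = m0 + m2 * v - u * v"
  have st: "s \<in> \<rat>" "t \<in> \<rat>" using uv by (auto simp: s_def t_def)
  have "s * \<alpha> - t = \<alpha> ^ 3 - qeval m \<alpha> - (\<alpha> + u - m2) * (\<alpha>\<^sup>2 - (u * \<alpha> + v))"
    by (simp add: s_def t_def m qeval.simps algebra_simps power2_eq_square power3_eq_cube)
  then have "s * \<alpha> = t" using root sq by simp
  then have "s = 0"
    using alpha_irrational st by (metis Rats_divide nonzero_mult_div_cancel_left)
  then have "t = 0" using \<open>s * \<alpha> = t\<close> by simp
  have "(m2 - u) ^ 3 - qeval m (m2 - u) = (m2 - u) * s - t"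
    by (simp add: m qeval.simps s_def t_def algebra_simps power2_eq_square power3_eq_cube)
  then show False using no_rational_root[of "m2 - u"] uv \<open>s = 0\<close> \<open>t = 0\<close> by simp
qed

lemma independent:
  assumes "x \<in> \<rat>" "y \<in> \<rat>" "w \<in> \<rat>" and zero: "x + y * \<alpha> + w * \<alpha>\<^sup>2 = 0"
  shows "x = 0" "y = 0" "w = 0"
proof -
  show "w = 0"
  proof (rule ccontr)
    assume "w \<noteq> 0"
    then have "\<alpha>\<^sup>2 = (- y / w) * \<alpha> + (- x / w)"
      using zero by (simp add: field_simps eq_neg_iff_add_eq_0)
    then show False using alpha_not_quadratic[of "- y / w" "- x / w"] assms by simp
  qed
  show "y = 0"
  proof (rule ccontr)
    assume "y \<noteq> 0"
    then have "\<alpha> = - x / y" using zero \<open>w = 0\<close> by (simp add: field_simps add_eq_0_iff)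
    then show False using alpha_irrational assms by auto
  qed
  then show "x = 0" using zero \<open>w = 0\<close> by simp
qed

lemma qeval_eq_0_iff [simp]: "qeval g \<alpha> = 0 \<longleftrightarrow> g = (0, 0, 0)"
  using independent[of "of_int (fst g)" "of_int (fst (snd g))" "of_int (snd (snd g))"]
  by (cases g) (auto simp: qeval.simps)

lemma in_K_iff: "z \<in> K \<longleftrightarrow> (\<exists>n g. n \<noteq> 0 \<and> of_int n * z = qeval g \<alpha>)"
proof
  have frac: "\<exists>p q. q \<noteq> 0 \<and> u = of_int p / of_int q" if "u \<in> \<rat>" for u :: complex
    using that by (metis Rats_cases' less_numeral_extra(3))
  assume "z \<in> K"
  then obtain x y w where "x \<in> \<rat>" "y \<in> \<rat>" "w \<in> \<rat>" and z: "z = x + y * \<alpha> + w * \<alpha>\<^sup>2"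
    by (auto simp: K_def)
  with frac obtain p q p' q' p'' q'' where q: "q \<noteq> 0" "q' \<noteq> 0" "q'' \<noteq> 0"
    and pq: "x = of_int p / of_int q" "y = of_int p' / of_int q'" "w = of_int p'' / of_int q''"
    by metis
  have "of_int (q * q' * q'') * z = qeval (p * q' * q'', q * p' * q'', q * q' * p'') \<alpha>"
    unfolding z pq using q by (simp add: qeval.simps field_simps)
  then show "\<exists>n g. n \<noteq> 0 \<and> of_int n * z = qeval g \<alpha>" using q by (metis mult_eq_0_iff)
next
  assume "\<exists>n g. n \<noteq> 0 \<and> of_int n * z = qeval g \<alpha>"
  then obtain n k0 k1 k2 where "n \<noteq> 0" "of_int n * z = qeval (k0, k1, k2) \<alpha>" by (metis prod_cases3)
  then have "z = of_int k0 / of_int n + of_int k1 / of_int n * \<alpha> + of_int k2 / of_int n * \<alpha>\<^sup>2"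
    by (simp add: qeval.simps field_simps)
  then show "z \<in> K" unfolding K_def by (blast intro: Rats_divide Rats_of_int)
qed

lemma qeval_in_K: "qeval g \<alpha> \<in> K"
  unfolding in_K_iff by (intro exI[of _ 1] exI[of _ g]) simp

lemma Rats_subset_K: "\<rat> \<subseteq> K"
proof
  fix x :: complex assume "x \<in> \<rat>"
  then show "x \<in> K"
    unfolding K_def by (intro CollectI bexI[of _ x] bexI[of _ 0]) simp_all
qed

lemma mult_in_K:
  assumes "x \<in> K" "y \<in> K" shows "x * y \<in> K"
proof -
  obtain n g n' g' where "n \<noteq> 0" "of_int n * x = qeval g \<alpha>" "n' \<noteq> 0" "of_int n' * y = qeval g' \<alpha>"
    using assms unfolding in_K_iff by metis
  moreover have "of_int (n * n') * (x * y) = (of_int n * x) * (of_int n' * y)" by simp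
  ultimately have "of_int (n * n') * (x * y) = qeval (qmult m g g') \<alpha>" "n * n' \<noteq> 0"
    by (simp_all only: qeval_mult mult_eq_0_iff simp_thms)
  then show ?thesis unfolding in_K_iff by blast
qed

interpretation C: field "ring_of_type_algebra :: complex ring"
  by (rule field_from_type_algebra)

lemma subfield_Rats: "subfield \<rat> (ring_of_type_algebra :: complex ring)"
  by (intro C.subfieldI' C.subringI) auto

lemma dimension_K: "C.dimension 3 \<rat> K"
proof -
  have line: "C.line_extension \<rat> v S = {z. \<exists>x\<in>\<rat>. \<exists>s\<in>S. z = x * v + s}" for v S
    by (simp add: set_eq_iff C.line_extension_mem_iff)
  define S1 where "S1 = C.line_extension \<rat> (\<alpha>\<^sup>2) {0}"
  define S2 where "S2 = C.line_extension \<rat> \<alpha> S1"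
  have S1: "S1 = {z. \<exists>w\<in>\<rat>. z = w * \<alpha>\<^sup>2}" by (simp add: S1_def line)
  have S2: "S2 = {z. \<exists>y\<in>\<rat>. \<exists>w\<in>\<rat>. z = y * \<alpha> + w * \<alpha>\<^sup>2}"
    unfolding S2_def line S1 by blast
  have K: "K = C.line_extension \<rat> 1 S2"
    unfolding K_def line S2 mult_1_right add.assoc by blast
  have "\<alpha>\<^sup>2 \<notin> {0}" using independent(3)[of 0 0 1] by auto
  moreover have "\<alpha> \<notin> S1"
  proof
    assume "\<alpha> \<in> S1"
    then obtain w where "w \<in> \<rat>" "\<alpha> = w * \<alpha>\<^sup>2" by (auto simp: S1)
    then show False using independent(2)[of 0 1 "- w"] by simp
  qed
  moreover have "1 \<notin> S2"
  proof
    assume "1 \<in> S2"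
    then obtain y w where "y \<in> \<rat>" "w \<in> \<rat>" "1 = y * \<alpha> + w * \<alpha>\<^sup>2" by (auto simp: S2)
    then show False using independent(1)[of 1 "- y" "- w"] by (simp add: algebra_simps)
  qed
  moreover have "C.dimension 0 \<rat> {0}" using C.zero_dim[of \<rat>] by simp
  ultimately show ?thesis
    unfolding K S2_def S1_def numeral_3_eq_3 by (simp add: C.Suc_dim)
qed

lemma subfield_K: "subfield K (ring_of_type_algebra :: complex ring)"
proof (rule C.finite_dimension_imp_subfield[OF subfield_Rats _ Rats_subset_K])
  show finite: "C.finite_dimension \<rat> K"
    using dimension_K unfolding C.finite_dimension_def by blast
  interpret additive: subgroup K "add_monoid (ring_of_type_algebra :: complex ring)"
    using C.finite_dimension_imp_subalgebra[OF subfield_Rats finite] by (simp add: subalgebra_def)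
  have "1 \<in> K" "- 1 \<in> K" using Rats_subset_K by auto
  moreover have "x + y \<in> K" if "x \<in> K" "y \<in> K" for x y using additive.m_closed[OF that] by simp
  ultimately show "subring K (ring_of_type_algebra :: complex ring)"
    using mult_in_K mult_in_K[OF \<open>- 1 \<in> K\<close>] by (intro C.subringI) simp_all
qed

lemma cubic_number_field_K: "cubic_number_field K"
  unfolding cubic_number_field_def using subfield_K dimension_K by blast

end

definition some_root :: "quadratic \<Rightarrow> complex" where
  "some_root m = (SOME \<alpha>. \<alpha> ^ 3 = qeval m \<alpha>)"

lemma some_root: "some_root m ^ 3 = qeval m (some_root m)"
proof -
  obtain m0 m1 m2 where m: "m = (m0, m1, m2)" by (cases m)
  define f :: "complex poly" where "f = [:- of_int m0, - of_int m1, - of_int m2, 1:]"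
  have "\<not> constant (poly f)" by (simp add: constant_degree f_def)
  then obtain \<alpha> where "poly f \<alpha> = 0" using fundamental_theorem_of_algebra by blast
  then have "\<alpha> ^ 3 = qeval m \<alpha>"
    by (simp add: f_def m qeval.simps algebra_simps power2_eq_square power3_eq_cube)
  then show ?thesis unfolding some_root_def by (rule someI)
qed

lemma cubic_field_some_root:
  fixes q :: int
  assumes "q > 0" and no_root: "\<And>n. n \<in> {0..<q} \<Longrightarrow> \<not> q dvd n ^ 3 - qeval m n"
  shows "cubic_field m (some_root m)"
proof
  obtain m0 m1 m2 where m: "m = (m0, m1, m2)" by (cases m)
  show "n ^ 3 \<noteq> qeval m n" for n :: int
  proof
    assume "n ^ 3 = qeval m n"
    moreover have "[(n mod q) ^ 3 - qeval m (n mod q) = n ^ 3 - qeval m n] (mod q)"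
      unfolding m qeval.simps
      by (intro cong_diff cong_add cong_mult cong_pow cong_refl) (simp_all add: cong_def)
    ultimately have "q dvd (n mod q) ^ 3 - qeval m (n mod q)" by (simp add: cong_0_iff)
    then show False using no_root[of "n mod q"] \<open>q > 0\<close> by simp
  qed
qed (rule some_root)

section \<open>Reduction modulo primes of degree one\<close>

definition homogenize :: "'a::comm_ring_1 poly \<Rightarrow> 'a \<Rightarrow> 'a \<Rightarrow> 'a" where
  "homogenize f x y = (\<Sum>i\<le>degree f. coeff f i * x ^ i * y ^ (degree f - i))"

lemma homogenize_1: "homogenize f x 1 = poly f x"
  by (simp add: homogenize_def poly_altdef)

lemma homogenize_0: "homogenize f x 0 = lead_coeff f * x ^ degree f"
proof -
  have "homogenize f x 0 = (\<Sum>i\<le>degree f. if i = degree f then coeff f i * x ^ i else 0)"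
    unfolding homogenize_def by (intro sum.cong refl) (auto simp: power_0_left)
  then show ?thesis by simp
qed

lemma homogenize_scale: "homogenize f (t * x) (t * y) = t ^ degree f * homogenize f x y"
proof -
  have "coeff f i * (t * x) ^ i * (t * y) ^ (degree f - i)
      = t ^ degree f * (coeff f i * x ^ i * y ^ (degree f - i))" if "i \<le> degree f" for i
  proof -
    have "t ^ degree f = t ^ i * t ^ (degree f - i)" using that by (simp flip: power_add)
    then show ?thesis by (simp add: power_mult_distrib mult_ac)
  qed
  then show ?thesis unfolding homogenize_def sum_distrib_left by (intro sum.cong) auto
qed

lemma cong_homogenize:
  "[x = x'] (mod n) \<Longrightarrow> [y = y'] (mod n) \<Longrightarrow> [homogenize f x y = homogenize f x' y'] (mod n)"
  for x :: int
  unfolding homogenize_def by (intro cong_sum cong_mult cong_pow cong_refl)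

definition no_root_mod :: "int \<Rightarrow> int poly \<Rightarrow> bool" where
  "no_root_mod p f \<longleftrightarrow> list_all (\<lambda>w. \<not> p dvd poly f w) [0..p - 1]"

lemma no_root_mod_iff: "no_root_mod p f \<longleftrightarrow> (\<forall>w\<in>{0..<p}. \<not> p dvd poly f w)"
  by (auto simp: no_root_mod_def list_all_iff)

fun qderiv :: "quadratic \<Rightarrow> quadratic" where
  "qderiv (k0, k1, k2) = (k1, 2 * k2, 0)"

locale degree_one_prime = cubic_field +
  fixes p r :: int
  assumes prime: "Factorial_Ring.prime p" and root_mod: "[r ^ 3 = qeval m r] (mod p)"
    and simple_root: "\<not> p dvd 3 * r\<^sup>2 - qeval (qderiv m) r"
begin

text \<open>The graph of the ring homomorphism \<open>\<int>[\<alpha>] \<rightarrow> \<int> / p\<close> that maps \<open>\<alpha>\<close> to \<open>r\<close>.\<close>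

definition reduces_to :: "complex \<Rightarrow> int \<Rightarrow> bool" where
  "reduces_to z w \<longleftrightarrow> (\<exists>g. z = qeval g \<alpha> \<and> [qeval g r = w] (mod p))"

lemma reduces_to_qeval: "[qeval g r = w] (mod p) \<Longrightarrow> reduces_to (qeval g \<alpha>) w"
  unfolding reduces_to_def by blast

lemma reduces_to_of_int: "reduces_to (of_int n) n"
  using reduces_to_qeval[of "(n, 0, 0)" n] by (simp add: qeval.simps)

lemma reduces_to_add: "reduces_to z w \<Longrightarrow> reduces_to z' w' \<Longrightarrow> reduces_to (z + z') (w + w')"
  unfolding reduces_to_def by (metis qeval_add cong_add)

lemma reduces_to_mult:
  assumes "reduces_to z w" "reduces_to z' w'" shows "reduces_to (z * z') (w * w')"
proof -
  obtain g g' where z: "z = qeval g \<alpha>" "z' = qeval g' \<alpha>"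
    and w: "[qeval g r = w] (mod p)" "[qeval g' r = w'] (mod p)"
    using assms by (auto simp: reduces_to_def)
  obtain q where "qeval g r * qeval g' r = qeval (qmult m g g') r + q * (r ^ 3 - qeval m r)"
    by (rule qeval_mult_cofactor)
  moreover have "[r ^ 3 - qeval m r = 0] (mod p)" using root_mod by (simp add: cong_diff_iff_cong_0)
  ultimately have "[qeval g r * qeval g' r = qeval (qmult m g g') r] (mod p)"
    by (simp add: cong_0_iff cong_iff_dvd_diff)
  then have "[qeval (qmult m g g') r = w * w'] (mod p)"
    using cong_mult[OF w] by (metis cong_sym cong_trans)
  then show ?thesis unfolding z qeval_mult by (rule reduces_to_qeval)
qed

lemma reduces_to_power: "reduces_to z w \<Longrightarrow> reduces_to (z ^ n) (w ^ n)"
  by (induction n) (use reduces_to_of_int[of 1] in \<open>auto intro: reduces_to_mult\<close>)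

lemma reduces_to_minus: "reduces_to z w \<Longrightarrow> reduces_to (- z) (- w)"
  using reduces_to_mult[OF reduces_to_of_int[of "- 1"]] by fastforce

lemma reduces_to_diff: "reduces_to z w \<Longrightarrow> reduces_to z' w' \<Longrightarrow> reduces_to (z - z') (w - w')"
  using reduces_to_add[OF _ reduces_to_minus] by fastforce

lemma reduces_to_numeral: "reduces_to (numeral n) (numeral n)"
  using reduces_to_of_int[of "numeral n"] by simp

lemma reduces_to_sum:
  "(\<And>i. i \<in> I \<Longrightarrow> reduces_to (f i) (g i)) \<Longrightarrow> reduces_to (sum f I) (sum g I)"
  by (induction I rule: infinite_finite_induct)
    (use reduces_to_of_int[of 0] in \<open>auto intro: reduces_to_add\<close>)

lemma reduces_to_0: "reduces_to 0 w \<Longrightarrow> p dvd w"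
  by (auto simp: reduces_to_def qeval.simps cong_iff_dvd_diff dest: sym)

definition reduces_to_monic :: "complex poly \<Rightarrow> int poly \<Rightarrow> bool" where
  "reduces_to_monic f g \<longleftrightarrow> lead_coeff f = 1 \<and> lead_coeff g = 1 \<and> degree f = degree g \<and>
     (\<forall>i. reduces_to (coeff f i) (coeff g i))"

lemma reduces_to_monic_1: "reduces_to_monic [:1:] [:1:]"
  using reduces_to_of_int[of 1] reduces_to_of_int[of 0]
  by (auto simp: reduces_to_monic_def coeff_pCons split: nat.split)

lemma reduces_to_monic_pCons:
  assumes "reduces_to z w" "reduces_to_monic f g" shows "reduces_to_monic (pCons z f) (pCons w g)"
proof -
  have "f \<noteq> 0" "g \<noteq> 0" using assms(2) by (auto simp: reduces_to_monic_def)
  then show ?thesis using assms by (auto simp: reduces_to_monic_def coeff_pCons split: nat.split)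
qed

lemma reduces_to_homogenize:
  "reduces_to_monic f g \<Longrightarrow> reduces_to x u \<Longrightarrow> reduces_to y v \<Longrightarrow>
    reduces_to (homogenize f x y) (homogenize g u v)"
  by (auto simp: homogenize_def reduces_to_monic_def
      intro!: reduces_to_sum reduces_to_mult reduces_to_power)

text \<open>
  The quotient \<open>h = (f(X) - f(r)) / (X - r)\<close> for \<open>f = X\<^sup>3 - m\<close>. It reduces to \<open>f'(r)\<close>, and
  \<open>h(\<alpha>) (\<alpha> - r) = - f(r)\<close> is divisible by \<open>p\<close>.
\<close>

definition cofactor :: quadratic where
  "cofactor = (r\<^sup>2 - snd (snd m) * r - fst (snd m), r - snd (snd m), 1)"

lemma cofactor_reduction_nonzero: "\<not> p dvd qeval cofactor r"
proof -
  have "qeval cofactor r = 3 * r\<^sup>2 - qeval (qderiv m) r"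
    unfolding cofactor_def by (cases m) (simp add: qeval.simps algebra_simps power2_eq_square)
  then show ?thesis using simple_root by simp
qed

lemma cofactor_mult_root:
  "qeval cofactor \<alpha> * (\<alpha> - of_int r) = \<alpha> ^ 3 - qeval m \<alpha> - of_int (r ^ 3 - qeval m r)"
  unfolding cofactor_def
  by (cases m) (simp add: qeval.simps algebra_simps power2_eq_square power3_eq_cube)

lemma cofactor_mult_kernel:
  assumes "reduces_to z 0"
  shows "\<exists>u v. reduces_to u v \<and> qeval cofactor \<alpha> * z = of_int p * u"
proof -
  let ?h = "qeval cofactor \<alpha>"
  obtain s where "r ^ 3 - qeval m r = p * s"
    using root_mod by (auto simp: cong_iff_dvd_diff elim: dvdE)
  then have h: "?h * (\<alpha> - of_int r) = - (of_int p * of_int s)"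
    unfolding cofactor_mult_root by (simp add: root)
  obtain k0 k1 k2 where z: "z = qeval (k0, k1, k2) \<alpha>" and "p dvd qeval (k0, k1, k2) r"
    using assms unfolding reduces_to_def cong_0_iff by (metis prod_cases3)
  then obtain l where l: "qeval (k0, k1, k2) r = p * l" by blast
  define v where "v = qeval (k1 + k2 * r, k2, 0) \<alpha>"
  have "z = of_int (p * l) + (\<alpha> - of_int r) * v"
    unfolding l[symmetric] by (simp add: z v_def qeval.simps algebra_simps power2_eq_square)
  then have "?h * z = of_int p * of_int l * ?h + ?h * (\<alpha> - of_int r) * v"
    by (simp only: of_int_mult distrib_left mult_ac)
  then have "?h * z = of_int p * (of_int l * ?h - of_int s * v)"
    unfolding h by (simp add: algebra_simps)
  moreover have "\<exists>w. reduces_to (of_int l * ?h - of_int s * v) w"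
    unfolding v_def
    by (meson reduces_to_diff reduces_to_mult reduces_to_of_int reduces_to_qeval cong_refl)
  ultimately show ?thesis by blast
qed

lemma homogenize_root_mod:
  assumes "reduces_to_monic f g" "poly f z = 0" "reduces_to d v" "reduces_to (d * z) u"
  shows "p dvd homogenize g u v"
proof -
  have "homogenize f (d * z) (d * 1) = 0" unfolding homogenize_scale homogenize_1 assms(2) by simp
  then show ?thesis using reduces_to_homogenize[OF assms(1,4,3)] reduces_to_0 by simp
qed

text \<open>The localization of \<open>\<int>[\<alpha>]\<close> at the kernel of the reduction is integrally closed.\<close>

lemma denominator_descent:
  assumes fg: "reduces_to_monic f g" and z: "poly f z = 0"
    and d: "reduces_to d v" and "reduces_to (of_int (p * n) * d * z) u"
  shows "\<exists>w. reduces_to (of_int n * (qeval cofactor \<alpha> * d) * z) w"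
proof -
  have "reduces_to (of_int (p * n) * d) (p * n * v)"
    using d by (intro reduces_to_mult reduces_to_of_int)
  then have "p dvd homogenize g u (p * n * v)" using homogenize_root_mod[OF fg z] assms(4) by blast
  moreover have "[homogenize g u (p * n * v) = homogenize g u 0] (mod p)"
    by (intro cong_homogenize cong_refl) (simp add: cong_0_iff)
  ultimately have "p dvd u ^ degree g"
    using fg by (simp add: homogenize_0 cong_dvd_iff reduces_to_monic_def)
  then have "p dvd u" using prime prime_dvd_power by blast
  then have "reduces_to (of_int (p * n) * d * z) 0"
    using assms(4) unfolding reduces_to_def by (metis cong_0_iff cong_trans)
  then obtain x y where "reduces_to x y"
    and "qeval cofactor \<alpha> * (of_int (p * n) * d * z) = of_int p * x"
    using cofactor_mult_kernel by blast
  moreover have "p \<noteq> 0" using prime by auto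
  ultimately have "of_int n * (qeval cofactor \<alpha> * d) * z = x" by (simp add: mult_ac)
  then show ?thesis using \<open>reduces_to x y\<close> by blast
qed

lemma denominator_prime_to_reduction:
  assumes fg: "reduces_to_monic f g" and z: "z \<in> K" "poly f z = 0"
  obtains d u v where "reduces_to d v" and "\<not> p dvd v" and "reduces_to (d * z) u"
proof -
  have "\<exists>d u v. reduces_to d v \<and> \<not> p dvd v \<and> reduces_to (d * z) u"
    if "n \<noteq> 0" "reduces_to d v" "\<not> p dvd v" "reduces_to (of_int n * d * z) u" for n d u v
    using that
  proof (induction "nat \<bar>n\<bar>" arbitrary: n d u v rule: less_induct)
    case less
    show ?case
    proof (cases "p dvd n")
      case False
      then have "\<not> p dvd n * v" using less.prems(3) prime by (simp add: prime_dvd_mult_iff)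
      moreover have "reduces_to (of_int n * d) (n * v)"
        using less.prems(2) by (intro reduces_to_mult reduces_to_of_int)
      ultimately show ?thesis using less.prems(4) by blast
    next
      case True
      then obtain n' where n': "n = p * n'" ..
      then obtain w where "reduces_to (of_int n' * (qeval cofactor \<alpha> * d) * z) w"
        using denominator_descent[OF fg z(2)] less.prems(2,4) by blast
      moreover have "reduces_to (qeval cofactor \<alpha> * d) (qeval cofactor r * v)"
        by (intro reduces_to_mult reduces_to_qeval cong_refl less.prems(2))
      moreover have "\<not> p dvd qeval cofactor r * v"
        using cofactor_reduction_nonzero less.prems(3) prime by (simp add: prime_dvd_mult_iff)
      moreover have "nat \<bar>n'\<bar> < nat \<bar>n\<bar>" "n' \<noteq> 0"
        using less.prems(1) prime_gt_1_int[OF prime] by (simp_all add: n' abs_mult)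
      ultimately show ?thesis by (intro less.hyps)
    qed
  qed
  moreover obtain n k where "n \<noteq> 0" "of_int n * z = qeval k \<alpha>" using z(1) in_K_iff by blast
  moreover have "reduces_to 1 1" using reduces_to_of_int[of 1] by simp
  moreover have "\<not> p dvd 1" using prime by auto
  ultimately show thesis using that reduces_to_qeval[OF cong_refl] by (metis mult.right_neutral)
qed

theorem root_imp_root_mod:
  assumes fg: "reduces_to_monic f g" and z: "z \<in> K" "poly f z = 0"
  shows "\<exists>w\<in>{0..<p}. p dvd poly g w"
proof -
  obtain d u v where d: "reduces_to d v" "\<not> p dvd v" "reduces_to (d * z) u"
    using denominator_prime_to_reduction[OF assms] .
  have "coprime v p" using prime d(2) by (metis coprime_commute prime_imp_coprime)
  then obtain i where i: "[v * i = 1] (mod p)" using cong_solve_coprime_int by blast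
  have "p dvd homogenize g (i * u) (i * v)"
    using homogenize_root_mod[OF fg z(2) d(1,3)] by (simp add: homogenize_scale)
  moreover have "[homogenize g (i * u) (i * v) = homogenize g ((i * u) mod p) 1] (mod p)"
    using i by (intro cong_homogenize) (simp_all add: mult.commute)
  ultimately have "p dvd poly g ((i * u) mod p)" by (simp add: homogenize_1 cong_dvd_iff)
  moreover have "(i * u) mod p \<in> {0..<p}" using prime_gt_0_int[OF prime] by simp
  ultimately show ?thesis by blast
qed

lemma no_root_in_K:
  "no_root_mod p g \<Longrightarrow> reduces_to_monic f g \<Longrightarrow> z \<in> K \<Longrightarrow> poly f z \<noteq> 0"
  using root_imp_root_mod unfolding no_root_mod_iff by blast

end

section \<open>Curves over cubic fields\<close>

definition occurs_over_cubic_field :: "('b, 'd) monoid_scheme \<Rightarrow> bool" where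
  "occurs_over_cubic_field A \<longleftrightarrow>
     (\<exists>K E. cubic_number_field K \<and> elliptic_curve_over K E \<and>
        has_subgroup_isomorphic_to (mordell_weil_group K E) A)"

context cubic_field
begin

lemma qeval_arith:
  "qeval g \<alpha> + qeval h \<alpha> = qeval (qadd g h) \<alpha>"
  "qeval g \<alpha> - qeval h \<alpha> = qeval (qadd g (qscale (- 1) h)) \<alpha>"
  "- qeval g \<alpha> = qeval (qscale (- 1) g) \<alpha>"
  "qeval g \<alpha> * qeval h \<alpha> = qeval (qmult m g h) \<alpha>"
  "numeral n * qeval g \<alpha> = qeval (qscale (numeral n) g) \<alpha>"
  "(qeval g \<alpha>)\<^sup>2 = qeval (qmult m g g) \<alpha>"
  "qeval g \<alpha> ^ 3 = qeval (qmult m (qmult m g g) g) \<alpha>"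
  "qeval g \<alpha> = qeval h \<alpha> \<longleftrightarrow> g = h"
proof -
  have scale: "qeval (qscale n g) \<alpha> = of_int n * qeval g \<alpha>" for n g by (simp add: qeval_scale)
  show neg: "- qeval g \<alpha> = qeval (qscale (- 1) g) \<alpha>" for g by (simp add: scale)
  show diff: "qeval g \<alpha> - qeval h \<alpha> = qeval (qadd g (qscale (- 1) h)) \<alpha>" for g h
    by (simp add: scale flip: qeval_add)
  have "qeval g \<alpha> = qeval h \<alpha> \<longleftrightarrow> qeval g \<alpha> - qeval h \<alpha> = 0" by simp
  also have "\<dots> \<longleftrightarrow> g = h" unfolding diff qeval_eq_0_iff by (cases g; cases h) auto
  finally show "qeval g \<alpha> = qeval h \<alpha> \<longleftrightarrow> g = h" .
qed (simp_all add: qeval_add qeval_mult qeval_scale[symmetric] power2_eq_square power3_eq_cube)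

end

definition qdiscriminant :: "quadratic \<Rightarrow> quadratic \<Rightarrow> quadratic \<Rightarrow> quadratic \<Rightarrow> quadratic" where
  "qdiscriminant m a b c =
     (let ab = qmult m a b; cube = (\<lambda>g. qmult m (qmult m g g) g) in
      qadd (qadd (qmult m ab ab) (qscale (- 4) (cube b)))
        (qadd (qadd (qscale (- 4) (qmult m c (cube a))) (qscale (- 27) (qmult m c c)))
          (qscale 18 (qmult m c ab))))"

lemma (in cubic_field) discriminant_eq_qdiscriminant:
  "discriminant (Weierstrass 0 (qeval a \<alpha>) 0 (qeval b \<alpha>) (qeval c \<alpha>)) =
     16 * qeval (qdiscriminant m a b c) \<alpha>"
  unfolding discriminant_short qdiscriminant_def Let_def qeval_add[symmetric] qeval_scale[symmetric]
    qeval_mult[symmetric]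
  by (simp add: power2_eq_square power3_eq_cube)

locale cubic_curve = cubic_field +
  fixes a b c :: quadratic
  assumes qdiscriminant_nonzero: "qdiscriminant m a b c \<noteq> (0, 0, 0)"
begin

sublocale short_weierstrass_over "qeval a \<alpha>" "qeval b \<alpha>" "qeval c \<alpha>" K
  by (intro short_weierstrass_over.intro short_weierstrass.intro
      short_weierstrass_over_axioms.intro)
    (simp_all add: discriminant_eq_qdiscriminant qdiscriminant_nonzero subfield_K qeval_in_K)

lemma occurs_over_cubic_fieldI:
  "has_subgroup_isomorphic_to G A \<Longrightarrow> occurs_over_cubic_field A"
  unfolding occurs_over_cubic_field_def using cubic_number_field_K elliptic_curve by blast

lemmas curve_arith = qeval_arith qeval_in_K affine_in_carrier_iff poly_cubic
  add_eq_iff double_eq_iff add_eq_Infinity_iff Let_def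

abbreviation pt :: "quadratic \<Rightarrow> quadratic \<Rightarrow> complex point" where
  "pt g h \<equiv> Affine (qeval g \<alpha>) (qeval h \<alpha>)"

lemma pt_not_in_doubles:
  assumes "degree_one_prime m \<alpha> p r"
    and "no_root_mod p (halving_poly (qeval a r mod p) (qeval b r mod p) (qeval c r mod p)
      (qeval g r mod p))"
  shows "pt g h \<notin> MW.doubles"
proof -
  interpret degree_one_prime m \<alpha> p r by fact
  have "reduces_to (qeval k \<alpha>) (qeval k r mod p)" for k by (rule reduces_to_qeval) simp
  then have "reduces_to_monic (halving_poly (qeval a \<alpha>) (qeval b \<alpha>) (qeval c \<alpha>) (qeval g \<alpha>))
      (halving_poly (qeval a r mod p) (qeval b r mod p) (qeval c r mod p) (qeval g r mod p))"
    unfolding halving_poly_def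
    by (intro reduces_to_monic_pCons reduces_to_monic_1 reduces_to_add reduces_to_diff
        reduces_to_minus reduces_to_mult reduces_to_power reduces_to_numeral)
  then show ?thesis using assms(2) no_root_in_K not_in_doubles by blast
qed

lemma no_two_torsion:
  assumes "degree_one_prime m \<alpha> p r" and "no_root_mod p [:qeval c r, qeval b r, qeval a r, 1:]"
    and P: "P \<in> carrier G" "P \<otimes>\<^bsub>G\<^esub> P = \<one>\<^bsub>G\<^esub>"
  shows "P = \<one>\<^bsub>G\<^esub>"
proof (rule two_torsionE[OF P])
  interpret degree_one_prime m \<alpha> p r by fact
  have "reduces_to_monic cubic [:qeval c r, qeval b r, qeval a r, 1:]"
    unfolding cubic_def
    by (intro reduces_to_monic_pCons reduces_to_monic_1 reduces_to_qeval cong_refl)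
  then show ?thesis if "x \<in> K" "poly cubic x = 0" for x using that assms(2) no_root_in_K by blast
qed

lemma two_torsion_in_powers:
  assumes "degree_one_prime m \<alpha> p r" and c: "c = (0, 0, 0)"
    and "no_root_mod p [:qeval b r, qeval a r, 1:]"
    and T: "T [^]\<^bsub>G\<^esub> (k::nat) = pt (0, 0, 0) (0, 0, 0)"
    and P: "P \<in> carrier G" "P \<otimes>\<^bsub>G\<^esub> P = \<one>\<^bsub>G\<^esub>"
  shows "P \<in> MW.powers T"
proof (rule two_torsionE[OF P])
  show ?thesis if "P = \<one>\<^bsub>G\<^esub>" using MW.nat_pow_in_powers[of T 0] that by simp
next
  interpret degree_one_prime m \<alpha> p r by fact
  fix x assume x: "x \<in> K" "P = Affine x 0" "poly cubic x = 0"
  have "reduces_to_monic [:qeval b \<alpha>, qeval a \<alpha>, 1:] [:qeval b r, qeval a r, 1:]"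
    by (intro reduces_to_monic_pCons reduces_to_monic_1 reduces_to_qeval cong_refl)
  then have "poly [:qeval b \<alpha>, qeval a \<alpha>, 1:] x \<noteq> 0" using x(1) assms(3) no_root_in_K by blast
  moreover have "x * poly [:qeval b \<alpha>, qeval a \<alpha>, 1:] x = poly cubic x - qeval c \<alpha>"
    by (simp add: poly_cubic algebra_simps power2_eq_square power3_eq_cube)
  then have "x * poly [:qeval b \<alpha>, qeval a \<alpha>, 1:] x = 0 - qeval c \<alpha>" unfolding x(3) .
  then have "x * poly [:qeval b \<alpha>, qeval a \<alpha>, 1:] x = 0" using c by simp
  ultimately have "P = T [^]\<^bsub>G\<^esub> k" using x(2) T by simp
  then show ?thesis using MW.nat_pow_in_powers by simp
qed

lemma two_torsion_in_powers_mult_powers: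
  assumes a: "a = qscale (- 1) (qadd e1 (qadd e2 e3))"
    and b: "b = qadd (qmult m e1 e2) (qadd (qmult m e1 e3) (qmult m e2 e3))"
    and c: "c = qscale (- 1) (qmult m e1 (qmult m e2 e3))"
    and S: "S = pt e2 (0, 0, 0)" "S \<in> carrier G"
    and T: "T \<in> carrier G" "T [^]\<^bsub>G\<^esub> (k::nat) = pt e1 (0, 0, 0)"
    and sum: "S \<otimes>\<^bsub>G\<^esub> pt e1 (0, 0, 0) = pt e3 (0, 0, 0)"
    and P: "P \<in> carrier G" "P \<otimes>\<^bsub>G\<^esub> P = \<one>\<^bsub>G\<^esub>"
  shows "P \<in> MW.powers S <#>\<^bsub>G\<^esub> MW.powers T"
proof -
  have generated: "S [^]\<^bsub>G\<^esub> int i \<otimes>\<^bsub>G\<^esub> T [^]\<^bsub>G\<^esub> int j \<in> MW.powers S <#>\<^bsub>G\<^esub> MW.powers T" for i j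
    by (auto simp: set_mult_def)
  show ?thesis
  proof (rule two_torsionE[OF P])
    assume "P = \<one>\<^bsub>G\<^esub>"
    then show ?thesis using generated[of 0 0] by simp
  next
    fix x assume x: "P = Affine x 0" "poly cubic x = 0"
    have "poly cubic x = (x - qeval e1 \<alpha>) * ((x - qeval e2 \<alpha>) * (x - qeval e3 \<alpha>))"
      unfolding poly_cubic
      unfolding a b c qeval_add[symmetric] qeval_mult[symmetric] qeval_scale[symmetric]
      by (simp add: algebra_simps power2_eq_square power3_eq_cube)
    with x consider "P = pt e1 (0, 0, 0)" | "P = S" | "P = pt e3 (0, 0, 0)"
      using S(1) by auto
    then show ?thesis
    proof cases
      case 1
      then show ?thesis using generated[of 0 k] S(2) T by (simp add: int_pow_int)
    next
      case 2
      then show ?thesis using generated[of 1 0] S(2) T by (simp add: int_pow_int)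
    next
      case 3
      then show ?thesis using generated[of 1 k] S(2) T sum by (simp add: int_pow_int)
    qed
  qed
qed

end

lemma (in cubic_field) degree_one_prime_iff:
  "degree_one_prime m \<alpha> p r \<longleftrightarrow>
     Factorial_Ring.prime p \<and> p dvd r ^ 3 - qeval m r \<and> \<not> p dvd 3 * r\<^sup>2 - qeval (qderiv m) r"
  by (auto simp: degree_one_prime_def degree_one_prime_axioms_def cubic_field_axioms
      cong_iff_dvd_diff)

lemma cubic_curve_some_root:
  assumes "q > 0" and "no_root_mod q [:- m0, - m1, - m2, 1:]"
    and "qdiscriminant (m0, m1, m2) a b c \<noteq> (0, 0, 0)"
  shows "cubic_curve (m0, m1, m2) (some_root (m0, m1, m2)) a b c"
proof -
  have "poly [:- m0, - m1, - m2, 1:] n = n ^ 3 - qeval (m0, m1, m2) n" for n :: int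
    by (simp add: qeval.simps algebra_simps power2_eq_square power3_eq_cube)
  then have "\<not> q dvd n ^ 3 - qeval (m0, m1, m2) n" if "n \<in> {0..<q}" for n
    using assms(2) that by (metis no_root_mod_iff)
  then show ?thesis
    using assms(1,3) by (intro cubic_curve.intro cubic_curve_axioms.intro cubic_field_some_root)
qed

lemmas (in cubic_field) reduction_arith =
  degree_one_prime_iff no_root_mod_def upto.simps qeval.simps halving_poly_def

section \<open>Examples\<close>

text \<open>
  The curves come from cubic points on the modular curves that parametrise the torsion
  structures, and the points of infinite order from a search for points of small height.
\<close>

lemma occurs_Z11_Z_Z:
  "occurs_over_cubic_field (integer_mod_group 11 \<times>\<times> integer_group \<times>\<times> integer_group)"
proof -
  interpret cubic_curve "(-2, 9, -8)" "some_root (-2, 9, -8)"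
    "(320, -496, -23)" "(-896, 896, 1312)" "(3072, -8192, 9472)"
    by (rule cubic_curve_some_root[of 5])
      (simp_all add: no_root_mod_def upto.simps qdiscriminant_def Let_def)
  let ?T = "pt (0, 0, 0) (96, -176, -32)"
    and ?T2 = "pt (-256, 416, 48) (-1664, 2624, 256)"
    and ?T4 = "pt (128, -128, -16) (2304, -2944, -352)"
    and ?T5 = "pt (-48, 88, 16) (512, -912, 232)"
    and ?T10 = "pt (0, 0, 0) (-96, 176, 32)"
    and ?P = "pt (48, -40, 8) (-1008, 1832, -616)"
    and ?Q = "pt (-288, 384, 48) (-384, 352, 160)"
    and ?PQ = "pt (-64, 80, 48) (1280, -3584, 2576)"
  have carrier: "?T \<in> carrier G" "?P \<in> carrier G" "?Q \<in> carrier G"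
    by (simp_all add: curve_arith)
  have multiples: "?T \<otimes>\<^bsub>G\<^esub> ?T = ?T2" "?T2 \<otimes>\<^bsub>G\<^esub> ?T2 = ?T4" "?T4 \<otimes>\<^bsub>G\<^esub> ?T = ?T5" "?T5 \<otimes>\<^bsub>G\<^esub> ?T5 = ?T10"
    "?T10 \<otimes>\<^bsub>G\<^esub> ?T = \<one>\<^bsub>G\<^esub>"
    by (simp_all add: curve_arith)
  have sum: "?P \<otimes>\<^bsub>G\<^esub> ?Q = ?PQ"
    by (simp add: curve_arith)
  have ord: "MW.ord ?T = 11"
    by (rule MW.ord_eqI)
      (use multiples in \<open>simp_all add: carrier MW.nat_pow_binary[OF carrier(1)]\<close>)
  have not_double_17: "?P \<notin> MW.doubles" "?Q \<notin> MW.doubles"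
    by (rule pt_not_in_doubles[of 17 13]; simp add: reduction_arith)+
  have not_double_47: "?PQ \<notin> MW.doubles"
    by (rule pt_not_in_doubles[of 47 5]; simp add: reduction_arith)
  show ?thesis unfolding ord[symmetric]
  proof (rule occurs_over_cubic_fieldI, rule MW.has_subgroup_odd_cyclic_times_int_int[of ?T ?P ?Q])
    show "R = \<one>\<^bsub>G\<^esub>" if "R \<in> carrier G" "R \<otimes>\<^bsub>G\<^esub> R = \<one>\<^bsub>G\<^esub>" for R
      by (rule no_two_torsion[of 11 9, OF _ _ that]) (simp_all add: reduction_arith)
  qed (use carrier not_double_17 not_double_47 sum in \<open>simp_all add: ord\<close>)
qed

lemma occurs_Z13_Z:
  "occurs_over_cubic_field (integer_mod_group 13 \<times>\<times> integer_group)"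
proof -
  interpret cubic_curve "(-2, 0, -1)" "some_root (-2, 0, -1)"
    "(17, 12, 4)" "(32, 80, 32)" "(256, 256, 64)"
    by (rule cubic_curve_some_root[of 3])
      (simp_all add: no_root_mod_def upto.simps qdiscriminant_def Let_def)
  let ?T = "pt (0, 0, 0) (16, 8, 0)"
    and ?T2 = "pt (-16, -8, 0) (0, 32, 16)"
    and ?T3 = "pt (0, -8, 0) (-16, 0, -16)"
    and ?T6 = "pt (16, 8, 0) (-96, -80, -16)"
    and ?T12 = "pt (0, 0, 0) (-16, -8, 0)"
    and ?P = "pt (0, -4, -4) (-16, 4, 12)"
  have carrier: "?T \<in> carrier G" "?P \<in> carrier G"
    by (simp_all add: curve_arith)
  have multiples: "?T \<otimes>\<^bsub>G\<^esub> ?T = ?T2" "?T2 \<otimes>\<^bsub>G\<^esub> ?T = ?T3" "?T3 \<otimes>\<^bsub>G\<^esub> ?T3 = ?T6" "?T6 \<otimes>\<^bsub>G\<^esub> ?T6 = ?T12"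
    "?T12 \<otimes>\<^bsub>G\<^esub> ?T = \<one>\<^bsub>G\<^esub>"
    by (simp_all add: curve_arith)
  have ord: "MW.ord ?T = 13"
    by (rule MW.ord_eqI)
      (use multiples in \<open>simp_all add: carrier MW.nat_pow_binary[OF carrier(1)]\<close>)
  have not_double: "?P \<notin> MW.doubles"
    by (rule pt_not_in_doubles[of 17 8]; simp add: reduction_arith)
  show ?thesis unfolding ord[symmetric]
  proof (rule occurs_over_cubic_fieldI, rule MW.has_subgroup_odd_cyclic_times_int[of ?T ?P])
    show "R = \<one>\<^bsub>G\<^esub>" if "R \<in> carrier G" "R \<otimes>\<^bsub>G\<^esub> R = \<one>\<^bsub>G\<^esub>" for R
      by (rule no_two_torsion[of 7 2, OF _ _ that]) (simp_all add: reduction_arith)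
  qed (use carrier not_double in \<open>simp_all add: ord\<close>)
qed

lemma occurs_Z15_Z:
  "occurs_over_cubic_field (integer_mod_group 15 \<times>\<times> integer_group)"
proof -
  interpret cubic_curve "(-3, 3, -1)" "some_root (-3, 3, -1)"
    "(846, -162, -135)" "(209952, -49248, -41472)" "(26313984, -4478976, -3919104)"
    by (rule cubic_curve_some_root[of 7])
      (simp_all add: no_root_mod_def upto.simps qdiscriminant_def Let_def)
  let ?T = "pt (0, 0, 0) (5184, -432, -432)"
    and ?T2 = "pt (-432, 36, 36) (3564, -1620, -1296)"
    and ?T3 = "pt (-432, 144, 144) (-2592, 1296, 0)"
    and ?T4 = "pt (-108, -216, 324) (14580, -19656, 11772)"
    and ?T5 = "pt (-552, 144, 120) (648, 1344, 840)"
    and ?T6 = "pt (-216, 0, 0) (-3240, 216, 216)"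
    and ?T7 = "pt (864, -72, -72) (-38232, 5832, 5184)"
    and ?T14 = "pt (0, 0, 0) (-5184, 432, 432)"
    and ?P = "pt (108, -180, -72) (-3240, 2916, 2268)"
  have carrier: "?T \<in> carrier G" "?P \<in> carrier G"
    by (simp_all add: curve_arith)
  have multiples: "?T \<otimes>\<^bsub>G\<^esub> ?T = ?T2" "?T2 \<otimes>\<^bsub>G\<^esub> ?T = ?T3" "?T2 \<otimes>\<^bsub>G\<^esub> ?T2 = ?T4" "?T4 \<otimes>\<^bsub>G\<^esub> ?T = ?T5"
    "?T3 \<otimes>\<^bsub>G\<^esub> ?T3 = ?T6" "?T6 \<otimes>\<^bsub>G\<^esub> ?T = ?T7" "?T7 \<otimes>\<^bsub>G\<^esub> ?T7 = ?T14" "?T14 \<otimes>\<^bsub>G\<^esub> ?T = \<one>\<^bsub>G\<^esub>"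
    by (simp_all add: curve_arith)
  have ord: "MW.ord ?T = 15"
    by (rule MW.ord_eqI)
      (use multiples in \<open>simp_all add: carrier MW.nat_pow_binary[OF carrier(1)]\<close>)
  have not_double: "?P \<notin> MW.doubles"
    by (rule pt_not_in_doubles[of 23 5]; simp add: reduction_arith)
  show ?thesis unfolding ord[symmetric]
  proof (rule occurs_over_cubic_fieldI, rule MW.has_subgroup_odd_cyclic_times_int[of ?T ?P])
    show "R = \<one>\<^bsub>G\<^esub>" if "R \<in> carrier G" "R \<otimes>\<^bsub>G\<^esub> R = \<one>\<^bsub>G\<^esub>" for R
      by (rule no_two_torsion[of 17 7, OF _ _ that]) (simp_all add: reduction_arith)
  qed (use carrier not_double in \<open>simp_all add: ord\<close>)
qed

lemma occurs_Z16_Z: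
  "occurs_over_cubic_field (integer_mod_group 16 \<times>\<times> integer_group)"
proof -
  interpret cubic_curve "(2, -1, -6)" "some_root (2, -1, -6)"
    "(49, 8, -32)" "(-3072, 2048, 8960)" "(0, 0, 0)"
    by (rule cubic_curve_some_root[of 5])
      (simp_all add: no_root_mod_def upto.simps qdiscriminant_def Let_def)
  let ?T = "pt (-8, 8, 16) (-24, 24, 48)"
    and ?T2 = "pt (16, 32, 16) (-144, -288, -144)"
    and ?T4 = "pt (0, 0, 16) (0, -64, 16)"
    and ?T8 = "pt (0, 0, 0) (0, 0, 0)"
    and ?P = "pt (-8, -64, -8) (216, -192, -168)"
    and ?PT = "pt (-9, 8, 23) (54, -32, -154)"
  have carrier: "?T \<in> carrier G" "?P \<in> carrier G"
    by (simp_all add: curve_arith)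
  have multiples: "?T \<otimes>\<^bsub>G\<^esub> ?T = ?T2" "?T2 \<otimes>\<^bsub>G\<^esub> ?T2 = ?T4" "?T4 \<otimes>\<^bsub>G\<^esub> ?T4 = ?T8" "?T8 \<otimes>\<^bsub>G\<^esub> ?T8 = \<one>\<^bsub>G\<^esub>"
    by (simp_all add: curve_arith)
  have sum: "?P \<otimes>\<^bsub>G\<^esub> ?T = ?PT"
    by (simp add: curve_arith)
  have ord: "MW.ord ?T = 16"
    by (rule MW.ord_eqI)
      (use multiples in \<open>simp_all add: carrier MW.nat_pow_binary[OF carrier(1)]\<close>)
  have half_multiple: "?T [^]\<^bsub>G\<^esub> (8::nat) = ?T8"
    using multiples by (simp add: carrier MW.nat_pow_binary[OF carrier(1)])
  have not_double_11: "?T \<notin> MW.doubles" "?P \<notin> MW.doubles"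
    by (rule pt_not_in_doubles[of 11 8]; simp add: reduction_arith)+
  have not_double_13: "?PT \<notin> MW.doubles"
    by (rule pt_not_in_doubles[of 13 9]; simp add: reduction_arith)
  show ?thesis unfolding ord[symmetric]
  proof (rule occurs_over_cubic_fieldI, rule MW.has_subgroup_cyclic_times_int[of ?T ?P])
    show "R \<in> MW.powers ?T" if "R \<in> carrier G" "R \<otimes>\<^bsub>G\<^esub> R = \<one>\<^bsub>G\<^esub>" for R
      by (rule two_torsion_in_powers[of 11 8, OF _ _ _ half_multiple that])
        (simp_all add: reduction_arith)
  qed (use carrier not_double_11 not_double_13 sum in \<open>simp_all add: ord\<close>)
qed

lemma occurs_Z20_Z:
  "occurs_over_cubic_field (integer_mod_group 20 \<times>\<times> integer_group)"
proof -
  interpret cubic_curve "(-30, 36, -9)" "some_root (-30, 36, -9)"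
    "(13417, -6324, -612)" "(2377216, -1150464, -110592)" "(0, 0, 0)"
    by (rule cubic_curve_some_root[of 7])
      (simp_all add: no_root_mod_def upto.simps qdiscriminant_def Let_def)
  let ?T = "pt (-416, 56, 8) (-44160, 20392, 1976)"
    and ?T2 = "pt (64, 192, 16) (-155520, 81600, 7760)"
    and ?T4 = "pt (64, 0, 0) (25920, -11904, -1152)"
    and ?T5 = "pt (-3104, 1488, 144) (140832, -68400, -6576)"
    and ?T10 = "pt (0, 0, 0) (0, 0, 0)"
    and ?P = "pt (654, -318, -29) (55500, -26860, -2570)"
    and ?PT = "pt (-2144, 1036, 100) (91008, -44068, -4236)"
  have carrier: "?T \<in> carrier G" "?P \<in> carrier G"
    by (simp_all add: curve_arith)
  have multiples: "?T \<otimes>\<^bsub>G\<^esub> ?T = ?T2" "?T2 \<otimes>\<^bsub>G\<^esub> ?T2 = ?T4" "?T4 \<otimes>\<^bsub>G\<^esub> ?T = ?T5" "?T5 \<otimes>\<^bsub>G\<^esub> ?T5 = ?T10"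
    "?T10 \<otimes>\<^bsub>G\<^esub> ?T10 = \<one>\<^bsub>G\<^esub>"
    by (simp_all add: curve_arith)
  have sum: "?P \<otimes>\<^bsub>G\<^esub> ?T = ?PT"
    by (simp add: curve_arith)
  have ord: "MW.ord ?T = 20"
    by (rule MW.ord_eqI)
      (use multiples in \<open>simp_all add: carrier MW.nat_pow_binary[OF carrier(1)]\<close>)
  have half_multiple: "?T [^]\<^bsub>G\<^esub> (10::nat) = ?T10"
    using multiples by (simp add: carrier MW.nat_pow_binary[OF carrier(1)])
  have not_double_13: "?T \<notin> MW.doubles" "?PT \<notin> MW.doubles"
    by (rule pt_not_in_doubles[of 13 11]; simp add: reduction_arith)+
  have not_double_19: "?P \<notin> MW.doubles"
    by (rule pt_not_in_doubles[of 19 12]; simp add: reduction_arith)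
  show ?thesis unfolding ord[symmetric]
  proof (rule occurs_over_cubic_fieldI, rule MW.has_subgroup_cyclic_times_int[of ?T ?P])
    show "R \<in> MW.powers ?T" if "R \<in> carrier G" "R \<otimes>\<^bsub>G\<^esub> R = \<one>\<^bsub>G\<^esub>" for R
      by (rule two_torsion_in_powers[of 13 11, OF _ _ _ half_multiple that])
        (simp_all add: reduction_arith)
  qed (use carrier not_double_13 not_double_19 sum in \<open>simp_all add: ord\<close>)
qed

lemma occurs_Z2_Z10_Z:
  "occurs_over_cubic_field (integer_mod_group 2 \<times>\<times> integer_mod_group 10 \<times>\<times> integer_group)"
proof -
  interpret cubic_curve "(-3, -15, -19)" "some_root (-3, -15, -19)"
    "(-116, -260, -23)" "(-2592, -2880, 6624)" "(0, 0, 0)"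
    by (rule cubic_curve_some_root[of 5])
      (simp_all add: no_root_mod_def upto.simps qdiscriminant_def Let_def)
  let ?T = "pt (-36, -84, 0) (-288, -660, -36)"
    and ?T2 = "pt (252, 576, 36) (-684, -1584, -108)"
    and ?T4 = "pt (744, 1704, 96) (7584, 17448, 936)"
    and ?T5 = "pt (0, 0, 0) (0, 0, 0)"
    and ?S = "pt (-108, -252, -9) (0, 0, 0)"
    and ?ST = "pt (372, 852, 48) (2112, 4884, 324)"
    and ?P = "pt (-48, -108, 12) (-492, -1596, -1104)"
    and ?PS = "pt (288, 588, 36) (2124, 4476, 240)"
    and ?PT = "pt (240, 550, 34) (-438, -1010, -56)"
    and ?PST = "pt (-12, -30, 2) (126, 306, 48)"
  have carrier: "?T \<in> carrier G" "?S \<in> carrier G" "?P \<in> carrier G"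
    by (simp_all add: curve_arith)
  have multiples: "?T \<otimes>\<^bsub>G\<^esub> ?T = ?T2" "?T2 \<otimes>\<^bsub>G\<^esub> ?T2 = ?T4" "?T4 \<otimes>\<^bsub>G\<^esub> ?T = ?T5" "?T5 \<otimes>\<^bsub>G\<^esub> ?T5 = \<one>\<^bsub>G\<^esub>"
    by (simp_all add: curve_arith)
  have sums: "?S \<otimes>\<^bsub>G\<^esub> ?S = \<one>\<^bsub>G\<^esub>" "?S \<otimes>\<^bsub>G\<^esub> ?T = ?ST" "?P \<otimes>\<^bsub>G\<^esub> ?S = ?PS" "?P \<otimes>\<^bsub>G\<^esub> ?T = ?PT"
    "?PS \<otimes>\<^bsub>G\<^esub> ?T = ?PST"
    by (simp_all add: curve_arith)
  have ord: "MW.ord ?T = 10"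
    by (rule MW.ord_eqI)
      (use multiples in \<open>simp_all add: carrier MW.nat_pow_binary[OF carrier(1)]\<close>)
  have half_multiple: "?T [^]\<^bsub>G\<^esub> (5::nat) = ?T5"
    using multiples by (simp add: carrier MW.nat_pow_binary[OF carrier(1)])
  have not_double_13: "?S \<notin> MW.doubles" "?T \<notin> MW.doubles" "?ST \<notin> MW.doubles" "?P \<notin> MW.doubles"
    "?PS \<notin> MW.doubles" "?PT \<notin> MW.doubles"
    by (rule pt_not_in_doubles[of 13 2]; simp add: reduction_arith)+
  have not_double_17: "?PST \<notin> MW.doubles"
    by (rule pt_not_in_doubles[of 17 14]; simp add: reduction_arith)
  show ?thesis unfolding ord[symmetric]
  proof (rule occurs_over_cubic_fieldI,
      rule MW.has_subgroup_two_times_cyclic_times_int[of ?S ?T ?P])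
    show "R \<in> MW.powers ?S <#>\<^bsub>G\<^esub> MW.powers ?T"
      if "R \<in> carrier G" "R \<otimes>\<^bsub>G\<^esub> R = \<one>\<^bsub>G\<^esub>" for R
      using carrier half_multiple that
      by (intro two_torsion_in_powers_mult_powers[of
          "(0, 0, 0)" "(-108, -252, -9)" "(224, 512, 32)"])
        (simp_all add: curve_arith)
  qed (use carrier not_double_13 not_double_17 sums in \<open>simp_all add: ord\<close>)
qed

lemma occurs_Z2_Z12_Z:
  "occurs_over_cubic_field (integer_mod_group 2 \<times>\<times> integer_mod_group 12 \<times>\<times> integer_group)"
proof -
  interpret cubic_curve "(-2, -1, -1)" "some_root (-2, -1, -1)"
    "(123, -49, 14)" "(1152, 3136, 1728)" "(0, 0, 0)"
    by (rule cubic_curve_some_root[of 3])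
      (simp_all add: no_root_mod_def upto.simps qdiscriminant_def Let_def)
  let ?T = "pt (-56, 24, 48) (-120, -496, -304)"
    and ?T2 = "pt (144, 96, 16) (-2224, -1776, -480)"
    and ?T3 = "pt (-48, -40, -8) (496, 152, -224)"
    and ?T4 = "pt (16, 16, 4) (-232, -276, -92)"
    and ?T6 = "pt (0, 0, 0) (0, 0, 0)"
    and ?S = "pt (-128, 64, 0) (0, 0, 0)"
    and ?ST = "pt (560, 392, -16) (-15456, -14208, -2056)"
    and ?P = "pt (-80, -80, 16) (-1360, 240, 400)"
    and ?PS = "pt (38, 97, 26) (690, 1115, 770)"
    and ?PT = "pt (120, 256, 120) (-568, 3352, 2736)"
    and ?PST = "pt (-96, 0, 56) (432, 1144, 664)"
  have carrier: "?T \<in> carrier G" "?S \<in> carrier G" "?P \<in> carrier G"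
    by (simp_all add: curve_arith)
  have multiples: "?T \<otimes>\<^bsub>G\<^esub> ?T = ?T2" "?T2 \<otimes>\<^bsub>G\<^esub> ?T = ?T3" "?T2 \<otimes>\<^bsub>G\<^esub> ?T2 = ?T4" "?T3 \<otimes>\<^bsub>G\<^esub> ?T3 = ?T6"
    "?T6 \<otimes>\<^bsub>G\<^esub> ?T6 = \<one>\<^bsub>G\<^esub>"
    by (simp_all add: curve_arith)
  have sums: "?S \<otimes>\<^bsub>G\<^esub> ?S = \<one>\<^bsub>G\<^esub>" "?S \<otimes>\<^bsub>G\<^esub> ?T = ?ST" "?P \<otimes>\<^bsub>G\<^esub> ?S = ?PS" "?P \<otimes>\<^bsub>G\<^esub> ?T = ?PT"
    "?PS \<otimes>\<^bsub>G\<^esub> ?T = ?PST"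
    by (simp_all add: curve_arith)
  have ord: "MW.ord ?T = 12"
    by (rule MW.ord_eqI)
      (use multiples in \<open>simp_all add: carrier MW.nat_pow_binary[OF carrier(1)]\<close>)
  have half_multiple: "?T [^]\<^bsub>G\<^esub> (6::nat) = ?T6"
    using multiples by (simp add: carrier MW.nat_pow_binary[OF carrier(1)])
  have not_double_23: "?S \<notin> MW.doubles" "?T \<notin> MW.doubles" "?ST \<notin> MW.doubles" "?P \<notin> MW.doubles"
    "?PS \<notin> MW.doubles" "?PST \<notin> MW.doubles"
    by (rule pt_not_in_doubles[of 23 12]; simp add: reduction_arith)+
  have not_double_41: "?PT \<notin> MW.doubles"
    by (rule pt_not_in_doubles[of 41 12]; simp add: reduction_arith)
  show ?thesis unfolding ord[symmetric]
  proof (rule occurs_over_cubic_fieldI,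
      rule MW.has_subgroup_two_times_cyclic_times_int[of ?S ?T ?P])
    show "R \<in> MW.powers ?S <#>\<^bsub>G\<^esub> MW.powers ?T"
      if "R \<in> carrier G" "R \<otimes>\<^bsub>G\<^esub> R = \<one>\<^bsub>G\<^esub>" for R
      using carrier half_multiple that
      by (intro two_torsion_in_powers_mult_powers[of
          "(0, 0, 0)" "(-128, 64, 0)" "(5, -15, -14)"])
        (simp_all add: curve_arith)
  qed (use carrier not_double_23 not_double_41 sums in \<open>simp_all add: ord\<close>)
qed

lemma occurs_Z2_Z14_Z:
  "occurs_over_cubic_field (integer_mod_group 2 \<times>\<times> integer_mod_group 14 \<times>\<times> integer_group)"
proof -
  interpret cubic_curve "(536, 166, 1)" "some_root (536, 166, 1)"
    "(125316, 0, 0)" "(-274437275710946076645120, 0, 0)"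
    "(55319731060053040407430335575396352, 0, 0)"
    by (rule cubic_curve_some_root[of 5])
      (simp_all add: no_root_mod_def upto.simps qdiscriminant_def Let_def)
  let ?T = "pt (108452476512, 39020394816, -1000522944)
      (-232587702771024384, 6892796662667136, -176738375965824)"
    and ?T2 = "pt (188494312032, -36018825984, 3001568832)
      (-154822817346061824, -44538070743387648, 3711505895282304)"
    and ?T3 = "pt (340073538048, 9755098704, -750392208)
      (34198875749386944, 8615995828333920, -662768909871840)"
    and ?T6 = "pt (1001919465504, 22511766240, -4502353248)
      (-850995280275442560, -27836294214617280, 5567258842923456)"
    and ?T7 = "pt (-823868153472, -34142845464, 7524766308) (0, 0, 0)"
    and ?S = "pt (223283328564, -27795778038, -1928091090) (0, 0, 0)"
    and ?ST7 = "pt (600584699592, 61938623502, -5596675218) (0, 0, 0)"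
    and ?P = "pt (310361615712, 0, 0) (6349984184973312, 0, 0)"
    and ?PS = "pt (-1202736434400, -174003687216, 18705625776)
      (1654864573187995776, 275166987004727136, -26325692437407840)"
    and ?PT7 = "pt (674536200192, 109407227040, 942175872)
      (-421924730573512512, -138836277090418752, -6372625844676096)"
    and ?PST7 = "pt (2974960627200, 64596460176, -19647801648)
      (-4759634717702579520, -136330709914308384, 32698318282083936)"
  have carrier: "?T \<in> carrier G" "?S \<in> carrier G" "?P \<in> carrier G"
    by (simp_all add: curve_arith)
  have multiples: "?T \<otimes>\<^bsub>G\<^esub> ?T = ?T2" "?T2 \<otimes>\<^bsub>G\<^esub> ?T = ?T3" "?T3 \<otimes>\<^bsub>G\<^esub> ?T3 = ?T6" "?T6 \<otimes>\<^bsub>G\<^esub> ?T = ?T7"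
    "?T7 \<otimes>\<^bsub>G\<^esub> ?T7 = \<one>\<^bsub>G\<^esub>"
    by (simp_all add: curve_arith)
  have sums: "?S \<otimes>\<^bsub>G\<^esub> ?S = \<one>\<^bsub>G\<^esub>" "?S \<otimes>\<^bsub>G\<^esub> ?T7 = ?ST7" "?P \<otimes>\<^bsub>G\<^esub> ?S = ?PS" "?P \<otimes>\<^bsub>G\<^esub> ?T7 = ?PT7"
    "?PS \<otimes>\<^bsub>G\<^esub> ?T7 = ?PST7"
    by (simp_all add: curve_arith)
  have ord: "MW.ord ?T = 14"
    by (rule MW.ord_eqI)
      (use multiples in \<open>simp_all add: carrier MW.nat_pow_binary[OF carrier(1)]\<close>)
  have half_multiple: "?T [^]\<^bsub>G\<^esub> (7::nat) = ?T7"
    using multiples by (simp add: carrier MW.nat_pow_binary[OF carrier(1)])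
  have not_double_31_15: "?S \<notin> MW.doubles" "?T7 \<notin> MW.doubles" "?ST7 \<notin> MW.doubles" "?P \<notin> MW.doubles"
    "?PS \<notin> MW.doubles" "?PT7 \<notin> MW.doubles"
    by (rule pt_not_in_doubles[of 31 15]; simp add: reduction_arith)+
  have not_double_31_18: "?PST7 \<notin> MW.doubles"
    by (rule pt_not_in_doubles[of 31 18]; simp add: reduction_arith)
  txt \<open>The coordinates of \<open>P + T\<close> and \<open>P + S + T\<close> are not integral.\<close>
  show ?thesis unfolding ord[symmetric]
  proof (rule occurs_over_cubic_fieldI,
      rule MW.has_subgroup_two_times_cyclic_times_int_odd_power[of ?S ?T ?P 7 ?T7])
    show "R \<in> MW.powers ?S <#>\<^bsub>G\<^esub> MW.powers ?T"
      if "R \<in> carrier G" "R \<otimes>\<^bsub>G\<^esub> R = \<one>\<^bsub>G\<^esub>" for R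
      using carrier half_multiple that
      by (intro two_torsion_in_powers_mult_powers[of
          "(-823868153472, -34142845464, 7524766308)"
          "(223283328564, -27795778038, -1928091090)"
          "(600584699592, 61938623502, -5596675218)"])
        (simp_all add: curve_arith)
  qed (use carrier not_double_31_15 not_double_31_18 half_multiple sums in \<open>simp_all add: ord\<close>)
qed

theorem theorem3p3:
  shows
    "(\<exists>K E. cubic_number_field K \<and> elliptic_curve_over K E \<and>
        has_subgroup_isomorphic_to (mordell_weil_group K E)
          (integer_mod_group 11 \<times>\<times> integer_group \<times>\<times> integer_group)) \<and>
     (\<exists>K E. cubic_number_field K \<and> elliptic_curve_over K E \<and>
        has_subgroup_isomorphic_to (mordell_weil_group K E)
          (integer_mod_group 13 \<times>\<times> integer_group)) \<and>
     (\<exists>K E. cubic_number_field K \<and> elliptic_curve_over K E \<and>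
        has_subgroup_isomorphic_to (mordell_weil_group K E)
          (integer_mod_group 15 \<times>\<times> integer_group)) \<and>
     (\<exists>K E. cubic_number_field K \<and> elliptic_curve_over K E \<and>
        has_subgroup_isomorphic_to (mordell_weil_group K E)
          (integer_mod_group 16 \<times>\<times> integer_group)) \<and>
     (\<exists>K E. cubic_number_field K \<and> elliptic_curve_over K E \<and>
        has_subgroup_isomorphic_to (mordell_weil_group K E)
          (integer_mod_group 20 \<times>\<times> integer_group)) \<and>
     (\<exists>K E. cubic_number_field K \<and> elliptic_curve_over K E \<and>
        has_subgroup_isomorphic_to (mordell_weil_group K E)
          (integer_mod_group 2 \<times>\<times> integer_mod_group 10 \<times>\<times> integer_group)) \<and>
     (\<exists>K E. cubic_number_field K \<and> elliptic_curve_over K E \<and>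
        has_subgroup_isomorphic_to (mordell_weil_group K E)
          (integer_mod_group 2 \<times>\<times> integer_mod_group 12 \<times>\<times> integer_group)) \<and>
     (\<exists>K E. cubic_number_field K \<and> elliptic_curve_over K E \<and>
        has_subgroup_isomorphic_to (mordell_weil_group K E)
          (integer_mod_group 2 \<times>\<times> integer_mod_group 14 \<times>\<times> integer_group))"
  using occurs_Z11_Z_Z occurs_Z13_Z occurs_Z15_Z occurs_Z16_Z occurs_Z20_Z
    occurs_Z2_Z10_Z occurs_Z2_Z12_Z occurs_Z2_Z14_Z
  unfolding occurs_over_cubic_field_def by (intro conjI)

end
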